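(* Let $n\ge2$, $p\ge2$ and $q>p-1$. Let $f:[0,\infty)\to[0,\infty)$ be strictly positive and locally Lipschitz continuous on $(0,\infty)$, continuous at $0$, such that the limit $$\ell=\lim_{t\to0^+}\frac{f(t)}{t^{p-1}}$$ exists and belongs to $(0,+\infty)$, and such that there is a constant $c>0$ with $f(t)\ge c\,t^q$ for all $t>0$. Then the problem $$-\Delta_pu=f(u)\ \text{ in }\mathbb R^n_+,\qquad u=0\ \text{ on }\partial\mathbb R^n_+$$ has no non-negative nontrivial solution $u\in W^{1,p}_{loc}(\mathbb R^n_+)\cap L^q_{loc}(\mathbb R^n_+)$ with $|\nabla u|\in L^\infty(\mathbb R^n_+)$.
   Context: $\mathbb R^n_+=\{x=(x',x_n)\in\mathbb R^{n-1}\times\mathbb R:x_n>0\}$ and $\Delta_pu=\operatorname{div}(|\nabla u|^{p-2}\nabla u)$. Solutions are understood in the distributional sense: $\int_{\mathbb R^n_+}|\nabla u|^{p-2}\nabla u\cdot\nabla\psi\,dx=\int_{\mathbb R^n_+}f(u)\psi\,dx$ for all $\psi\in C_0^\infty(\mathbb R^n_+)$; since $|\nabla u|\in L^\infty$, $u$ is identified with its Lipschitz representative, which extends continuously to $\overline{\mathbb R^n_+}$, and the boundary condition $u=0$ is imposed on this extension. *)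

theory Defs
  imports "HOL-Analysis.Analysis"
begin

primrec Ck_on :: "nat \<Rightarrow> 'a::euclidean_space set \<Rightarrow> ('a \<Rightarrow> real) \<Rightarrow> bool" where
  "Ck_on 0 S f \<longleftrightarrow> continuous_on S f"
| "Ck_on (Suc k) S f \<longleftrightarrow>
     (\<forall>x\<in>S. f differentiable (at x)) \<and>
     (\<forall>v. Ck_on k S (\<lambda>x. frechet_derivative f (at x) v))"

definition smooth_on :: "'a::euclidean_space set \<Rightarrow> ('a \<Rightarrow> real) \<Rightarrow> bool" where
  "smooth_on S f \<longleftrightarrow> (\<forall>k. Ck_on k S f)"

text \<open>Elements of \<open>C\<^sub>0\<^sup>\<infinity>(\<Omega>)\<close> are represented by their extension by zero to the whole space.\<close>

definition test_functions :: "'a::euclidean_space set \<Rightarrow> ('a \<Rightarrow> real) set" where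
  "test_functions \<Omega> = {\<psi>. smooth_on UNIV \<psi> \<and> compact (closure {x. \<psi> x \<noteq> 0}) \<and> closure {x. \<psi> x \<noteq> 0} \<subseteq> \<Omega>}"

definition gradient :: "('a::euclidean_space \<Rightarrow> real) \<Rightarrow> 'a \<Rightarrow> 'a" where
  "gradient \<psi> x = (\<Sum>i\<in>Basis. frechet_derivative \<psi> (at x) i *\<^sub>R i)"

text \<open>Functions on \<open>\<Omega>\<close> are total functions whose values outside \<open>\<Omega>\<close> are irrelevant; Lebesgue and
  Sobolev spaces consist of functions rather than of almost-everywhere equivalence classes.\<close>

definition Lp_loc :: "real \<Rightarrow> 'a::euclidean_space set \<Rightarrow> ('a \<Rightarrow> 'b::euclidean_space) set" where
  "Lp_loc p \<Omega> = {u. u \<in> borel_measurable (lebesgue_on \<Omega>) \<and>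
     (\<forall>K. compact K \<and> K \<subseteq> \<Omega> \<longrightarrow> integrable (lebesgue_on K) (\<lambda>x. norm (u x) powr p))}"

definition Linfty :: "'a::euclidean_space set \<Rightarrow> ('a \<Rightarrow> 'b::euclidean_space) set" where
  "Linfty \<Omega> = {u. u \<in> borel_measurable (lebesgue_on \<Omega>) \<and>
     (\<exists>M. AE x in lebesgue_on \<Omega>. norm (u x) \<le> M)}"

definition has_weak_gradient ::
    "'a::euclidean_space set \<Rightarrow> ('a \<Rightarrow> real) \<Rightarrow> ('a \<Rightarrow> 'a) \<Rightarrow> bool" where
  "has_weak_gradient \<Omega> u g \<longleftrightarrow> u \<in> Lp_loc 1 \<Omega> \<and> g \<in> Lp_loc 1 \<Omega> \<and>
     (\<forall>\<psi>\<in>test_functions \<Omega>.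
        (LINT x|lebesgue_on \<Omega>. u x *\<^sub>R gradient \<psi> x) = - (LINT x|lebesgue_on \<Omega>. \<psi> x *\<^sub>R g x))"

text \<open>On an open set the weak gradient is unique up to null sets, so none of the notions below
  depends on which one is chosen.\<close>

definition weak_gradient :: "'a::euclidean_space set \<Rightarrow> ('a \<Rightarrow> real) \<Rightarrow> 'a \<Rightarrow> 'a" where
  "weak_gradient \<Omega> u = (SOME g. has_weak_gradient \<Omega> u g)"

definition W1p_loc :: "real \<Rightarrow> 'a::euclidean_space set \<Rightarrow> ('a \<Rightarrow> real) set" where
  "W1p_loc p \<Omega> = {u. u \<in> Lp_loc p \<Omega> \<and> (\<exists>g. has_weak_gradient \<Omega> u g \<and> g \<in> Lp_loc p \<Omega>)}"

text \<open>\<open>-\<Delta>\<^sub>p u = f(u)\<close> in \<open>\<Omega>\<close> in the sense of distributions. The integrability conjuncts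
  say that both integrals exist (the integral of a non-integrable function is \<open>0\<close> by convention).
  For \<open>p = 2\<close> the convention \<open>0 powr 0 = 0\<close> is harmless, because the factor multiplies
  the zero vector.\<close>

definition p_laplace_solution ::
    "real \<Rightarrow> (real \<Rightarrow> real) \<Rightarrow> 'a::euclidean_space set \<Rightarrow> ('a \<Rightarrow> real) \<Rightarrow> bool" where
  "p_laplace_solution p f \<Omega> u \<longleftrightarrow>
     (\<forall>\<psi>\<in>test_functions \<Omega>.
        integrable (lebesgue_on \<Omega>)
          (\<lambda>x. (norm (weak_gradient \<Omega> u x) powr (p - 2) *\<^sub>R weak_gradient \<Omega> u x) \<bullet> gradient \<psi> x) \<and>
        integrable (lebesgue_on \<Omega>) (\<lambda>x. f (u x) * \<psi> x) \<and>
        (LINT x|lebesgue_on \<Omega>.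
           (norm (weak_gradient \<Omega> u x) powr (p - 2) *\<^sub>R weak_gradient \<Omega> u x) \<bullet> gradient \<psi> x) =
        (LINT x|lebesgue_on \<Omega>. f (u x) * \<psi> x))"

text \<open>The Lipschitz representative \<open>v\<close> of \<open>u\<close>, extended continuously to the closure,
  vanishes on the boundary.\<close>

definition zero_on_boundary :: "'a::euclidean_space set \<Rightarrow> ('a \<Rightarrow> real) \<Rightarrow> bool" where
  "zero_on_boundary \<Omega> u \<longleftrightarrow>
     (\<exists>v. (AE x in lebesgue_on \<Omega>. v x = u x) \<and> (\<exists>L. L-lipschitz_on \<Omega> v) \<and>
          continuous_on (closure \<Omega>) v \<and> (\<forall>x\<in>frontier \<Omega>. v x = 0))"

text \<open>With \<open>'a = real ^ 'm\<close> this is the half-space in dimension \<open>n = CARD('m) + 1\<close>, which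
  ranges over all \<open>n \<ge> 2\<close>.\<close>

definition half_space :: "('a::euclidean_space \<times> real) set" where
  "half_space = {x. snd x > 0}"

end

theory Submission
  imports Defs "HOL-Computational_Algebra.Polynomial"
begin

text \<open>
  The two conditions on \<open>f\<close> combine to \<open>f t \<ge> c' t\<^sup>p\<^sup>-\<^sup>1\<close> for all \<open>t \<ge> 0\<close>, so that \<open>u\<close> is a
  supersolution of an eigenvalue problem. Testing the equation with \<open>\<eta> (u + \<epsilon>)\<^sup>1\<^sup>-\<^sup>p\<close>, where \<open>\<eta>\<close> is
  a power of a bump function of a ball of radius \<open>R\<close>, and absorbing the mixed term bounds
  \<open>\<integral> \<bar>\<nabla>u\<bar>\<^sup>p (u + \<epsilon>)\<^sup>-\<^sup>p \<eta> / 2 + \<integral> f(u) (u + \<epsilon>)\<^sup>1\<^sup>-\<^sup>p \<eta>\<close> by a constant times \<open>R\<^sup>-\<^sup>p \<bar>B\<^sub>R\<bar>\<close>,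
  uniformly in \<open>\<epsilon>\<close>.

  The first integral controls the gradient of \<open>ln (u + \<epsilon>)\<close>. If \<open>u\<close> vanished on a set of positive
  measure but not identically, translating a piece of this set into a ball where \<open>u\<close> is positive
  would make \<open>ln (u + \<epsilon>)\<close> grow without bound as \<open>\<epsilon> \<rightarrow> 0\<close>; hence \<open>u > 0\<close> almost everywhere. Letting
  \<open>\<epsilon> \<rightarrow> 0\<close> in the second integral then gives \<open>c' \<bar>B\<^sub>R\<bar> \<le> C R\<^sup>-\<^sup>p \<bar>B\<^sub>R\<bar>\<close>, which is false for large \<open>R\<close>.

  The test function is made smooth by replacing \<open>u\<close> with mollifications, whose gradients converge
  almost everywhere to the weak gradient.
\<close>

section \<open>Smooth functions\<close>

text \<open>The estimate is a non-sharp form of a classical principle: a positive supersolution with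
  parameter c' exists in a ball only if c' is at most the first Dirichlet eigenvalue of that ball,
  which scales like R^(-p), and the half-space contains balls of every radius. Homogeneity dictates
  the exponent 1 - p: it bounds the reaction term below by c' (u / (u + \<epsilon>))^(p-1) and turns
  the diffusion term into the p-th power of the gradient of ln (u + \<epsilon>), so neither depends
  on the size of u, which is not controlled globally. The obstacle is the zero set: as \<epsilon>
  tends to 0, u / (u + \<epsilon>) tends to the indicator of {u > 0}, so the zero set must be null
  before the reaction term can contradict anything. Smoothing takes place only inside the test
  function. Flux and reaction term keep the original u and its weak gradient, so the nonlinear flux
  is never passed through a limit; the test functions alone have to converge, boundedly and almost
  everywhere together with their gradients.\<close>

lemma frechet_derivative_eqI:
  "(f has_derivative D) (at x) \<Longrightarrow> frechet_derivative f (at x) = D"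
  by (metis frechet_derivative_at)

lemma Ck_on_SucI:
  assumes "\<And>x. (f has_derivative D x) (at x)" "\<And>v. Ck_on k UNIV (\<lambda>x. D x v)"
  shows "Ck_on (Suc k) UNIV f"
  using assms by (auto simp: frechet_derivative_eqI[OF assms(1)] differentiable_def)

lemma Ck_on_SucD: "Ck_on (Suc k) UNIV f \<Longrightarrow> Ck_on k UNIV f"
proof (induction k arbitrary: f)
  case 0
  then show ?case
    by (auto simp: continuous_on_eq_continuous_at differentiable_imp_continuous_within)
next
  case (Suc k)
  then show ?case by (metis Ck_on.simps(2))
qed

lemma Ck_on_Suc_has_derivative:
  "Ck_on (Suc k) UNIV f \<Longrightarrow> (f has_derivative frechet_derivative f (at x)) (at x)"
  by (simp add: frechet_derivative_works)

lemma Ck_on_const: "Ck_on k UNIV (\<lambda>x. c)"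
proof (induction k arbitrary: c)
  case (Suc k)
  show ?case by (rule Ck_on_SucI[where D="\<lambda>x v. 0"]) (auto intro: Suc.IH)
qed auto

lemma Ck_on_add:
  "Ck_on k UNIV f \<Longrightarrow> Ck_on k UNIV g \<Longrightarrow> Ck_on k UNIV (\<lambda>x. f x + g x)"
proof (induction k arbitrary: f g)
  case (Suc k)
  show ?case
    by (rule Ck_on_SucI[where D="\<lambda>x v. frechet_derivative f (at x) v + frechet_derivative g (at x) v"])
       (use Suc in \<open>auto intro!: has_derivative_add Ck_on_Suc_has_derivative Suc.IH\<close>)
qed (auto intro: continuous_intros)

lemma Ck_on_mult:
  "Ck_on k UNIV f \<Longrightarrow> Ck_on k UNIV g \<Longrightarrow> Ck_on k UNIV (\<lambda>x. f x * g x)"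
proof (induction k arbitrary: f g)
  case (Suc k)
  have *: "Ck_on k UNIV f" "Ck_on k UNIV g" using Suc.prems by (auto intro: Ck_on_SucD)
  show ?case
    by (rule Ck_on_SucI[where D="\<lambda>x v. f x * frechet_derivative g (at x) v + frechet_derivative f (at x) v * g x"])
       (use Suc * in \<open>auto intro!: has_derivative_mult Ck_on_Suc_has_derivative Ck_on_add Suc.IH\<close>)
qed (auto intro: continuous_intros)

lemma Ck_on_sum:
  "finite I \<Longrightarrow> (\<And>i. i \<in> I \<Longrightarrow> Ck_on k UNIV (f i)) \<Longrightarrow> Ck_on k UNIV (\<lambda>x. \<Sum>i\<in>I. f i x)"
  by (induction I rule: finite_induct) (auto intro: Ck_on_const Ck_on_add)

lemma Ck_on_inner: "Ck_on k UNIV (\<lambda>x. x \<bullet> b)"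
proof (cases k)
  case (Suc m)
  show ?thesis unfolding Suc
    by (rule Ck_on_SucI[where D="\<lambda>x v. v \<bullet> b"]) (auto intro!: Ck_on_const derivative_eq_intros)
qed (auto intro: continuous_intros)

text \<open>Differentiating \<open>H j\<close> after \<open>f\<close> produces
  \<open>H (Suc j)\<close> after \<open>f\<close>, so the induction has to treat the whole family of
  derivatives at once, with \<open>j\<close> arbitrary. The set \<open>T\<close> confines the
  derivative hypothesis to where \<open>f\<close> takes its values; for real powers this is the
  positive half-line.\<close>

lemma Ck_on_compose:
  assumes H: "\<And>k t. t \<in> T \<Longrightarrow> (H k has_real_derivative H (Suc k) t) (at t)"
    and f: "\<And>x. f x \<in> T" and "\<And>k. Ck_on k UNIV f"
  shows "Ck_on k UNIV (\<lambda>x. H j (f x))"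
proof (induction k arbitrary: j)
  case 0
  have "continuous_on UNIV f" using assms(3)[of 0] by simp
  moreover have "isCont (H j) (f x)" for x using H[OF f] DERIV_isCont by blast
  ultimately show ?case
    by (auto simp: continuous_on_eq_continuous_at intro: isCont_o2)
next
  case (Suc k)
  have d: "(f has_derivative frechet_derivative f (at x)) (at x)" for x
    using assms(3)[of "Suc 0"] by (rule Ck_on_Suc_has_derivative)
  show ?case
  proof (rule Ck_on_SucI[where D="\<lambda>x v. H (Suc j) (f x) * frechet_derivative f (at x) v"])
    fix x
    show "((\<lambda>x. H j (f x)) has_derivative (\<lambda>v. H (Suc j) (f x) * frechet_derivative f (at x) v)) (at x)"
      using has_derivative_compose[OF d, of "H j" "(*) (H (Suc j) (f x))" x]
        H[OF f, of j x] by (simp add: has_field_derivative_def)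
  next
    fix v
    show "Ck_on k UNIV (\<lambda>x. H (Suc j) (f x) * frechet_derivative f (at x) v)"
      by (intro Ck_on_mult Suc.IH) (use assms(3)[of "Suc k"] in auto)
  qed
qed

lemma smooth_on_deriv:
  "smooth_on UNIV f \<Longrightarrow> smooth_on UNIV (\<lambda>x. frechet_derivative f (at x) v)"
  unfolding smooth_on_def by (metis Ck_on.simps(2))

lemma smooth_on_has_derivative:
  "smooth_on UNIV f \<Longrightarrow> (f has_derivative frechet_derivative f (at x)) (at x)"
  unfolding smooth_on_def by (metis Ck_on_Suc_has_derivative)

lemma smooth_on_continuous: "smooth_on UNIV f \<Longrightarrow> continuous_on UNIV f"
  unfolding smooth_on_def by (metis Ck_on.simps(1))

lemma smooth_on_mult:
  "smooth_on UNIV f \<Longrightarrow> smooth_on UNIV g \<Longrightarrow> smooth_on UNIV (\<lambda>x. f x * g x)"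
  unfolding smooth_on_def by (blast intro: Ck_on_mult)

lemma smooth_on_const: "smooth_on UNIV (\<lambda>x. c)"
  unfolding smooth_on_def by (blast intro: Ck_on_const)

lemma smooth_on_power: "smooth_on UNIV f \<Longrightarrow> smooth_on UNIV (\<lambda>x. f x ^ n)"
  by (induction n) (auto intro: smooth_on_const smooth_on_mult)

lemma smooth_on_compose:
  assumes "\<And>k t. t \<in> T \<Longrightarrow> (H k has_real_derivative H (Suc k) t) (at t)"
    and "\<And>x. f x \<in> T" and "smooth_on UNIV f"
  shows "smooth_on UNIV (\<lambda>x. H j (f x))"
  using Ck_on_compose[of T H f] assms unfolding smooth_on_def by metis

lemma smooth_on_powr:
  fixes f :: "'a::euclidean_space \<Rightarrow> real"
  assumes "smooth_on UNIV f" "\<And>x. f x > 0"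
  shows "smooth_on UNIV (\<lambda>x. f x powr s)"
proof -
  \<comment> \<open>The \<open>k\<close>-th derivative of \<open>t powr s\<close> for t > 0; the
    product is the falling factorial of \<open>s\<close>.\<close>
  define H where "H k t = (\<Prod>i<k. s - real i) * t powr (s - real k)" for k t
  have "smooth_on UNIV (\<lambda>x. H 0 (f x))"
  proof (rule smooth_on_compose[where T="{0<..}" and H=H and j=0])
    fix k :: nat and t :: real assume t: "t \<in> {0<..}"
    show "(H k has_real_derivative H (Suc k) t) (at t)"
      unfolding H_def using t
      by (auto intro!: derivative_eq_intros simp: algebra_simps)
  qed (use assms in auto)
  then show ?thesis by (simp add: H_def)
qed

lemma continuous_on_gradient:
  assumes "smooth_on UNIV f" shows "continuous_on UNIV (gradient f)"
  unfolding gradient_def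
  by (intro continuous_intros smooth_on_continuous smooth_on_deriv assms)

lemma gradient_inner:
  assumes "smooth_on UNIV f" shows "gradient f x \<bullet> v = frechet_derivative f (at x) v"
proof -
  have lin: "linear (frechet_derivative f (at x))"
    using smooth_on_has_derivative[OF assms] has_derivative_linear by blast
  have "frechet_derivative f (at x) v = frechet_derivative f (at x) (\<Sum>i\<in>Basis. (v \<bullet> i) *\<^sub>R i)"
    by (simp add: euclidean_representation)
  also have "\<dots> = (\<Sum>i\<in>Basis. (v \<bullet> i) * frechet_derivative f (at x) i)"
    by (simp add: linear_sum[OF lin] linear_cmul[OF lin])
  finally show ?thesis unfolding gradient_def
    by (simp add: inner_sum_left mult.commute inner_commute[of v])
qed

section \<open>Bump functions built from exp (-1/t)\<close>

text \<open>With s = 1/t one has ds/dt = -s^2, so the t-derivative of P(s) exp(-s) is s^2 (P(s) -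
  P'(s)) exp(-s). This is the recursion, with \<open>[:0, 0, 1:]\<close> standing for s^2.\<close>

fun flat_poly :: "nat \<Rightarrow> real poly" where
  "flat_poly 0 = 1"
| "flat_poly (Suc k) = [:0, 0, 1:] * (flat_poly k - pderiv (flat_poly k))"

text \<open>The \<open>k\<close>-th derivative of the function \<open>exp (-1/t)\<close>, continued by \<open>0\<close> to \<open>t \<le> 0\<close>.\<close>

definition flat :: "nat \<Rightarrow> real \<Rightarrow> real" where
  "flat k t = (if t \<le> 0 then 0 else poly (flat_poly k) (1/t) * exp (- (1/t)))"

lemma poly_times_exp_tendsto_0:
  fixes P :: "real poly" shows "((\<lambda>s. poly P s * exp (- s)) \<longlongrightarrow> 0) at_top"
proof -
  have "((\<lambda>s::real. \<Sum>i\<le>degree P. coeff P i * (s ^ i / exp s)) \<longlongrightarrow> (\<Sum>i\<le>degree P. coeff P i * 0)) at_top"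
    by (intro tendsto_intros tendsto_power_div_exp_0)
  then show ?thesis
    by (simp add: poly_altdef sum_distrib_right sum_divide_distrib exp_minus field_simps)
qed

lemma flat_has_derivative: "(flat k has_real_derivative flat (Suc k) t) (at t)"
proof -
  consider "t < 0" | "t > 0" | "t = 0" by linarith
  then show ?thesis
  proof cases
    case 1
    have "((\<lambda>_. 0::real) has_real_derivative 0) (at t)" by simp
    then show ?thesis
      using 1 by (subst DERIV_cong_ev[OF refl _ refl, where g="\<lambda>_. 0"])
        (auto simp: flat_def intro!: eventually_mono[OF order_tendstoD(2)[OF tendsto_ident_at, of t 0]]
          eventually_nhds_in_open[of "{..<0}", THEN eventually_mono])
  next
    case 2
    have "((\<lambda>t. poly (flat_poly k) (1/t) * exp (- (1/t))) has_real_derivative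
        (poly (pderiv (flat_poly k)) (1/t) * (- (1/t^2))) * exp (- (1/t)) + exp (- (1/t)) * (1/t^2) * poly (flat_poly k) (1/t)) (at t)"
      using 2 by (auto intro!: derivative_eq_intros DERIV_chain2[OF poly_DERIV] simp: power2_eq_square)
    also have "(poly (pderiv (flat_poly k)) (1/t) * (- (1/t^2))) * exp (- (1/t)) + exp (- (1/t)) * (1/t^2) * poly (flat_poly k) (1/t)
      = flat (Suc k) t" using 2 by (simp add: flat_def field_simps power2_eq_square)
    finally show ?thesis
      using 2 by (subst DERIV_cong_ev[OF refl _ refl, where g="\<lambda>t. poly (flat_poly k) (1/t) * exp (- (1/t))"])
        (auto simp: flat_def intro!: eventually_nhds_in_open[of "{0<..}", THEN eventually_mono])
  next
    case 3
    \<comment> \<open>The right difference quotient at 0 is P(1/h) exp(-1/h) / h. After the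
      substitution s = 1/h the division by h is the extra factor \<open>[:0,1:]\<close>, and the
      exponential wins.\<close>
    have "((\<lambda>s. poly ([:0,1:] * flat_poly k) s * exp (- s)) \<longlongrightarrow> 0) at_top"
      by (rule poly_times_exp_tendsto_0)
    from filterlim_compose[OF this filterlim_inverse_at_top_right]
    have "((\<lambda>t. poly ([:0,1:] * flat_poly k) (inverse t) * exp (- inverse t)) \<longlongrightarrow> 0) (at_right 0)" .
    then have r: "((\<lambda>h. flat k h / h) \<longlongrightarrow> 0) (at_right 0)"
      by (rule Lim_transform_eventually)
        (auto simp: flat_def eventually_at_right_field field_simps intro!: exI[of _ 1])
    have l: "((\<lambda>h. flat k h / h) \<longlongrightarrow> 0) (at_left 0)"
      by (rule Lim_transform_eventually[OF tendsto_const])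
        (auto simp: flat_def eventually_at_left_field intro!: exI[of _ "-1"])
    show ?thesis using filterlim_split_at[OF l r]
      by (simp add: 3 DERIV_def flat_def)
  qed
qed

lemma flat_0: "t > 0 \<Longrightarrow> flat 0 t = exp (- (1/t))" "t \<le> 0 \<Longrightarrow> flat k t = 0"
  by (auto simp: flat_def)

lemma flat_bounds: "0 \<le> flat 0 t" "flat 0 t \<le> 1" "flat 0 t = 0 \<longleftrightarrow> t \<le> 0"
  by (auto simp: flat_def)

lemma flat_mono: "s \<le> t \<Longrightarrow> flat 0 s \<le> flat 0 t"
  by (auto simp: flat_def frac_le)

text \<open>In the variable s = 1/t the value is s^2 exp(-s), while exp s is at least s^2 / 2. The
  constant 2 enters the gradient bound for bumps.\<close>

lemma flat_1_bound: "\<bar>flat 1 t\<bar> \<le> 2"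
proof (cases "t > 0")
  case True
  define s where "s = 1/t"
  have "s > 0" using True by (simp add: s_def)
  have "s^2 / 2 \<le> exp s"
    using exp_lower_Taylor_quadratic[of s] \<open>s > 0\<close> by linarith
  then have "s^2 * exp (-s) \<le> 2" by (simp add: exp_minus field_simps)
  moreover have "flat 1 t = s^2 * exp (-s)"
    using True by (simp add: flat_def s_def power2_eq_square pderiv_1)
  ultimately show ?thesis by simp
qed (simp add: flat_def)

text \<open>The squared norm keeps the function smooth at the centre. Dividing by r^2 makes all
  bumps rescaled copies of one profile, with gradient of order 1/r.\<close>

definition bump :: "'a::euclidean_space \<Rightarrow> real \<Rightarrow> 'a \<Rightarrow> real" where
  "bump z r x = flat 0 (1 - (norm (x - z))\<^sup>2 / r\<^sup>2)"

lemma bump_bounds: "0 \<le> bump z r x" "bump z r x \<le> 1"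
  by (simp_all add: bump_def flat_bounds)

lemma bump_minus: "bump z r x = bump 0 r (x - z)"
  by (simp add: bump_def)

lemma bump_eq_0_iff:
  assumes "r > 0" shows "bump z r x = 0 \<longleftrightarrow> x \<notin> ball z r"
proof -
  have "1 - (norm (x - z))\<^sup>2 / r\<^sup>2 \<le> 0 \<longleftrightarrow> r \<le> norm (x - z)"
    using assms by (simp add: field_simps power2_le_iff_abs_le flip: abs_le_square_iff)
  then show ?thesis by (auto simp: bump_def flat_bounds dist_norm norm_minus_commute)
qed

lemma bump_ge:
  assumes "0 \<le> s" "s < r" "x \<in> cball z s" shows "flat 0 (1 - s\<^sup>2 / r\<^sup>2) \<le> bump z r x"
  unfolding bump_def using assms
  by (intro flat_mono diff_left_mono divide_right_mono power_mono)
     (auto simp: dist_norm norm_minus_commute)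

lemma bump_has_derivative:
  "(bump z r has_derivative (\<lambda>v. flat 1 (1 - (norm (x - z))\<^sup>2 / r\<^sup>2) * (- (2 * ((x - z) \<bullet> v) / r\<^sup>2)))) (at x)"
proof -
  have *: "((\<lambda>x. 1 - (norm (x - z))\<^sup>2 / r\<^sup>2) has_derivative (\<lambda>v. - (2 * ((x - z) \<bullet> v) / r\<^sup>2))) (at x)"
  proof -
    have "((\<lambda>x. (x - z) \<bullet> (x - z)) has_derivative (\<lambda>v. 2 * ((x - z) \<bullet> v))) (at x)"
      by (auto intro!: derivative_eq_intros simp: inner_commute)
    from has_derivative_diff[OF has_derivative_const bounded_linear.has_derivative[OF bounded_linear_divide this]]
    show ?thesis unfolding power2_norm_eq_inner by simp
  qed
  show ?thesis
    using has_derivative_compose[OF *, of "flat 0" "(*) (flat 1 (1 - (norm (x - z))\<^sup>2 / r\<^sup>2))"]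
      flat_has_derivative[of 0 "1 - (norm (x - z))\<^sup>2 / r\<^sup>2"]
    by (simp add: bump_def[abs_def] has_field_derivative_def)
qed

lemma smooth_on_bump: "smooth_on UNIV (bump z r)"
proof -
  \<comment> \<open>Written as a polynomial in the coordinates, the inner function is smooth by
    closure under sums and products.\<close>
  have "Ck_on k UNIV (\<lambda>x. 1 + (- 1 / r\<^sup>2) * (\<Sum>i\<in>Basis. (x \<bullet> i + - (z \<bullet> i)) * (x \<bullet> i + - (z \<bullet> i))))" for k
    by (intro Ck_on_add Ck_on_mult Ck_on_const Ck_on_sum Ck_on_inner finite_Basis)
  moreover have "1 + (- 1 / r\<^sup>2) * (\<Sum>i\<in>Basis. (x \<bullet> i + - (z \<bullet> i)) * (x \<bullet> i + - (z \<bullet> i)))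
     = 1 - (norm (x - z))\<^sup>2 / r\<^sup>2" for x :: 'a
    unfolding power2_norm_eq_inner by (subst euclidean_inner) (simp add: inner_diff_left)
  ultimately have "smooth_on UNIV (\<lambda>x. 1 - (norm (x - z))\<^sup>2 / r\<^sup>2)" unfolding smooth_on_def by (simp only: simp_thms)
  then show ?thesis unfolding bump_def[abs_def]
    by (intro smooth_on_compose[where T=UNIV and H=flat] flat_has_derivative) auto
qed

text \<open>Chain rule: a factor 2 from the bound on \<open>flat 1\<close>, times 2 |x - z| / r^2,
  which is at most 2 / r on the ball.\<close>

lemma norm_gradient_bump_le:
  assumes "r > 0" "x \<in> cball z r" shows "norm (gradient (bump z r) x) \<le> 4 / r"
proof -
  let ?a = "flat 1 (1 - (norm (x - z))\<^sup>2 / r\<^sup>2)"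
  have "gradient (bump z r) x = (- (2 * ?a / r\<^sup>2)) *\<^sub>R (x - z)"
  proof (rule vector_eq_ldot[THEN iffD1, rule_format])
    fix v
    show "v \<bullet> gradient (bump z r) x = v \<bullet> (- (2 * ?a / r\<^sup>2)) *\<^sub>R (x - z)"
      unfolding inner_commute[of v] gradient_inner[OF smooth_on_bump] frechet_derivative_eqI[OF bump_has_derivative]
      by simp
  qed
  then have "norm (gradient (bump z r) x) = 2 * \<bar>?a\<bar> / r\<^sup>2 * norm (x - z)" by (simp add: abs_mult)
  also have "\<dots> \<le> 2 * 2 / r\<^sup>2 * r"
    using flat_1_bound assms by (intro mult_mono divide_right_mono) (auto simp: dist_norm norm_minus_commute)
  finally show ?thesis using assms by (simp add: power2_eq_square)
qed

section \<open>Mollification\<close>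

definition conv :: "('a::euclidean_space \<Rightarrow> real) \<Rightarrow> ('a \<Rightarrow> real) \<Rightarrow> 'a \<Rightarrow> real" where
  "conv \<rho> U x = (\<integral>y. \<rho> (x - y) * U y \<partial>lborel)"

lemma integrable_continuous_compact_support:
  fixes f :: "'a::euclidean_space \<Rightarrow> 'b::euclidean_space"
  assumes "continuous_on UNIV f" "compact K" "\<And>x. x \<notin> K \<Longrightarrow> f x = 0"
  shows "integrable lborel f"
proof -
  have "integrable lborel (\<lambda>x. indicator K x *\<^sub>R f x)"
    using assms by (intro borel_integrable_compact) (auto intro: continuous_on_subset)
  also have "(\<lambda>x. indicator K x *\<^sub>R f x) = f" using assms(3) by (auto simp: indicator_def)
  finally show ?thesis .
qed

lemma lborel_integral_eq_integral_cbox: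
  fixes f :: "'a::euclidean_space \<Rightarrow> 'b::euclidean_space"
  assumes "continuous_on UNIV f" "\<And>x. x \<notin> cbox a b \<Longrightarrow> f x = 0"
  shows "integral\<^sup>L lborel f = integral (cbox a b) f"
proof -
  have "integrable lborel f"
    using integrable_continuous_compact_support[OF assms(1) compact_cbox assms(2)] by blast
  then have "(f has_integral (integral\<^sup>L lborel f)) UNIV" by (rule has_integral_integral_lborel)
  moreover have "(\<lambda>x. if x \<in> cbox a b then f x else 0) = f" using assms(2) by auto
  ultimately have "(f has_integral (integral\<^sup>L lborel f)) (cbox a b)"
    using has_integral_restrict_UNIV[of "cbox a b" f] by simp
  then show ?thesis by (metis integral_unique)
qed

lemma frechet_derivative_eq_0_outside:
  assumes "\<And>x. x \<notin> cball 0 r \<Longrightarrow> \<rho> x = 0" "x \<notin> cball 0 r"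
  shows "frechet_derivative \<rho> (at x) v = 0"
proof -
  have "(\<rho> has_derivative (\<lambda>v. 0)) (at x)"
    by (rule has_derivative_transform_within_open[of "\<lambda>x. 0" _ _ _ "- cball 0 r"])
       (use assms in auto)
  then show ?thesis by (simp add: frechet_derivative_eqI)
qed

text \<open>Differentiation under the integral sign. For x within distance 1 of \<open>x0\<close>
  the integrand vanishes outside one fixed box, so locally the convolution is an integral over a
  compact box and the Leibniz rule applies.\<close>

lemma conv_has_derivative:
  fixes \<rho> :: "'a::euclidean_space \<Rightarrow> real"
  assumes \<rho>: "smooth_on UNIV \<rho>" "\<And>x. x \<notin> cball 0 r \<Longrightarrow> \<rho> x = 0" and U: "continuous_on UNIV U"
  shows "(conv \<rho> U has_derivative (\<lambda>v. conv (\<lambda>x. frechet_derivative \<rho> (at x) v) U x0)) (at x0)"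
proof -
  obtain a b where ab: "cball x0 (1 + r) \<subseteq> cbox a b"
    using bounded_subset_cbox_symmetric[OF bounded_cball] by metis
  have out: "x - y \<notin> cball 0 r" if "x \<in> ball x0 1" "y \<notin> cbox a b" for x y
  proof
    assume "x - y \<in> cball 0 r"
    then have "dist x0 y \<le> 1 + r"
      using that(1) dist_triangle[of x0 y x] by (simp add: dist_norm norm_minus_commute)
    then show False using ab that(2) by auto
  qed
  have cont: "continuous_on UNIV (\<lambda>y. s (x - y) * U y)" if "smooth_on UNIV s" for s x
    by (intro continuous_intros U continuous_on_compose2[OF smooth_on_continuous[OF that]]) auto
  \<comment> \<open>The Leibniz rule asks for the derivative as a bounded linear map that is jointly
    continuous in both variables; continuity can then be checked on basis vectors.\<close>
  define fx where "fx x t = U t *\<^sub>R Blinfun (frechet_derivative \<rho> (at (x - t)))" for x t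
  have app: "blinfun_apply (fx x t) v = U t * frechet_derivative \<rho> (at (x - t)) v" for x t v
    using smooth_on_has_derivative[OF \<rho>(1), of "x - t"]
    by (auto simp: fx_def bounded_linear_Blinfun_apply has_derivative_def scaleR_blinfun.rep_eq)
  have cfx: "continuous_on S (\<lambda>(x, t). fx x t)" for S
  proof (rule continuous_on_blinfun_componentwise)
    fix i :: 'a
    have "continuous_on S (\<lambda>z. U (snd z) * frechet_derivative \<rho> (at (fst z - snd z)) i)"
      by (intro continuous_intros continuous_on_compose2[OF U]
            continuous_on_compose2[OF smooth_on_continuous[OF smooth_on_deriv[OF \<rho>(1)]]]) auto
    then show "continuous_on S (\<lambda>x. blinfun_apply (case x of (x, t) \<Rightarrow> fx x t) i)"
      by (simp add: split_beta app)
  qed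
  have "((\<lambda>x. integral (cbox a b) (\<lambda>y. \<rho> (x - y) * U y)) has_derivative
      integral (cbox a b) (fx x0)) (at x0 within ball x0 1)"
  proof (rule leibniz_rule)
    fix x t
    show "((\<lambda>x. \<rho> (x - t) * U t) has_derivative blinfun_apply (fx x t)) (at x within ball x0 1)"
    proof -
      have "((\<lambda>x. x - t) has_derivative (\<lambda>v. v)) (at x)" by (auto intro!: derivative_eq_intros)
      from has_derivative_compose[OF this smooth_on_has_derivative[OF \<rho>(1)]]
      have "((\<lambda>x. \<rho> (x - t)) has_derivative frechet_derivative \<rho> (at (x - t))) (at x)" by simp
      from has_derivative_mult_left[OF this, of "U t"]
      show ?thesis by (simp add: app[abs_def] mult.commute has_derivative_at_withinI)
    qed
  next
    fix x
    show "(\<lambda>y. \<rho> (x - y) * U y) integrable_on cbox a b"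
      using cont[OF \<rho>(1)] by (intro integrable_continuous) (auto intro: continuous_on_subset)
  qed (auto intro: cfx)
  then have D: "((\<lambda>x. integral (cbox a b) (\<lambda>y. \<rho> (x - y) * U y)) has_derivative
      integral (cbox a b) (fx x0)) (at x0)"
    by (simp add: at_within_open[of x0 "ball x0 1"])
  have eq: "conv s U x = integral (cbox a b) (\<lambda>y. s (x - y) * U y)"
    if "x \<in> ball x0 1" "smooth_on UNIV s" "\<And>x. x \<notin> cball 0 r \<Longrightarrow> s x = 0" for x s
    unfolding conv_def using out[OF that(1)] that(3)
    by (intro lborel_integral_eq_integral_cbox cont that) auto
  have "(conv \<rho> U has_derivative integral (cbox a b) (fx x0)) (at x0)"
    by (rule has_derivative_transform_within_open[OF D, of "ball x0 1"]) (use eq \<rho> in auto)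
  moreover have "blinfun_apply (integral (cbox a b) (fx x0)) v =
     conv (\<lambda>x. frechet_derivative \<rho> (at x) v) U x0" for v
  proof -
    have "continuous_on (cbox a b) (fx x0)"
      using continuous_on_compose2[OF cfx[of UNIV] continuous_on_Pair[OF continuous_on_const continuous_on_id],
          of x0 "cbox a b"] by simp
    then have "fx x0 integrable_on cbox a b" by (rule integrable_continuous)
    moreover have "conv (\<lambda>x. frechet_derivative \<rho> (at x) v) U x0 =
        integral (cbox a b) (\<lambda>y. frechet_derivative \<rho> (at (x0 - y)) v * U y)"
      by (rule eq) (auto intro: smooth_on_deriv[OF \<rho>(1)] frechet_derivative_eq_0_outside[OF \<rho>(2)])
    ultimately show ?thesis by (simp add: blinfun_apply_integral app mult.commute)
  qed
  ultimately show ?thesis by (metis (no_types, lifting) ext)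
qed

text \<open>A derivative of a convolution is the convolution with a derivative of the kernel, which
  is again smooth and supported in the same ball. Hence the induction generalises over the kernel,
  while \<open>U\<close> is only continuous.\<close>

lemma smooth_on_conv:
  assumes "smooth_on UNIV \<rho>" "\<And>x. x \<notin> cball 0 r \<Longrightarrow> \<rho> x = 0" "continuous_on UNIV U"
  shows "smooth_on UNIV (conv \<rho> U)"
proof -
  have "Ck_on k UNIV (conv \<rho> U)" for k
    using assms(1,2)
  proof (induction k arbitrary: \<rho>)
    case 0
    then show ?case
      using has_derivative_continuous[OF conv_has_derivative[OF 0 assms(3)]]
      by (simp add: continuous_on_eq_continuous_at)
  next
    case (Suc k)
    show ?case
      by (rule Ck_on_SucI[OF conv_has_derivative[OF Suc.prems assms(3)]])
         (auto intro!: Suc.IH smooth_on_deriv Suc.prems frechet_derivative_eq_0_outside[OF Suc.prems(2)])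
  qed
  then show ?thesis by (simp add: smooth_on_def)
qed

lemma integral_lborel_translate:
  fixes f :: "'a::euclidean_space \<Rightarrow> 'b::{banach, second_countable_topology}"
  assumes [measurable]: "f \<in> borel_measurable borel"
  shows "(\<integral>x. f (c + x) \<partial>lborel) = integral\<^sup>L lborel f"
proof -
  have "integral\<^sup>L (distr lborel borel ((+) c)) f = (\<integral>x. f (c + x) \<partial>lborel)"
    by (rule integral_distr) auto
  then show ?thesis by (simp add: lborel_distr_plus)
qed

lemma nn_integral_lborel_translate:
  assumes [measurable]: "f \<in> borel_measurable borel"
  shows "(\<integral>\<^sup>+x. f (c + x :: 'a::euclidean_space) \<partial>lborel) = integral\<^sup>N lborel f"
proof -
  have "integral\<^sup>N (distr lborel borel ((+) c)) f = (\<integral>\<^sup>+x. f (c + x) \<partial>lborel)"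
    by (rule nn_integral_distr) auto
  then show ?thesis by (simp add: lborel_distr_plus)
qed

section \<open>The standard mollifier\<close>

definition moll :: "real \<Rightarrow> 'a::euclidean_space \<Rightarrow> real" where
  "moll r x = bump 0 r x / integral\<^sup>L lborel (bump 0 r :: 'a \<Rightarrow> real)"

lemma borel_measurable_bump [measurable]: "bump z r \<in> borel_measurable borel"
  by (intro borel_measurable_continuous_onI smooth_on_continuous smooth_on_bump)

lemma borel_measurable_moll [measurable]: "moll r \<in> borel_measurable borel"
  unfolding moll_def[abs_def] by measurable

lemma integrable_bump: "r > 0 \<Longrightarrow> integrable lborel (bump z r)"
  by (rule integrable_continuous_compact_support[of _ "cball z r"])
     (auto simp: smooth_on_continuous smooth_on_bump bump_eq_0_iff)

lemma emeasure_cball_less_top: "emeasure lborel (cball z s) < top"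
  using emeasure_lborel_cball_finite[of z s] by simp

lemma integral_bump_ge:
  fixes z :: "'a::euclidean_space"
  assumes "0 \<le> s" "s < r"
  shows "flat 0 (1 - s\<^sup>2 / r\<^sup>2) * measure lborel (cball z s) \<le> integral\<^sup>L lborel (bump z r)"
proof -
  have "(\<integral>x. flat 0 (1 - s\<^sup>2 / r\<^sup>2) * indicator (cball z s) x \<partial>lborel) \<le> integral\<^sup>L lborel (bump z r)"
    using bump_ge[OF assms, of _ z] assms
    by (intro integral_mono integrable_bump integrable_mult_right integrable_real_indicator)
       (auto simp: indicator_def bump_bounds emeasure_cball_less_top)
  then show ?thesis by simp
qed

lemma integral_bump_pos:
  fixes z :: "'a::euclidean_space"
  assumes "r > 0" shows "integral\<^sup>L lborel (bump z r) > 0"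
proof -
  have "0 < flat 0 (1 - (r/2)\<^sup>2 / r\<^sup>2) * measure lborel (cball z (r/2))"
    using assms by (intro mult_pos_pos) (auto simp: flat_0 power_divide content_cball_pos)
  also have "\<dots> \<le> integral\<^sup>L lborel (bump z r)"
    using assms by (intro integral_bump_ge) auto
  finally show ?thesis .
qed

lemma moll_nonneg: "moll r x \<ge> 0"
  by (auto simp: moll_def bump_bounds intro!: divide_nonneg_nonneg integral_nonneg)

lemma moll_commute: "moll r (x - y) = moll r (y - x)"
  by (simp add: moll_def bump_def norm_minus_commute)

lemma moll_eq_0: "r > 0 \<Longrightarrow> dist x y > r \<Longrightarrow> moll r (x - y) = 0"
  by (simp add: moll_def bump_eq_0_iff dist_norm norm_minus_commute)

lemma smooth_on_moll: "smooth_on UNIV (moll r :: 'a::euclidean_space \<Rightarrow> real)"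
  using smooth_on_mult[OF smooth_on_const smooth_on_bump, of "inverse (integral\<^sup>L lborel (bump 0 r :: 'a \<Rightarrow> real))" 0 r]
  by (simp add: moll_def[abs_def] field_simps)

lemma integrable_moll:
  fixes x :: "'a::euclidean_space"
  assumes "r > 0" shows "integrable lborel (\<lambda>y. moll r (x - y))"
proof -
  have "(\<lambda>y. moll r (x - y)) = (\<lambda>y. bump x r y / integral\<^sup>L lborel (bump 0 r :: 'a \<Rightarrow> real))"
    by (subst moll_commute) (simp add: moll_def bump_minus[of x])
  then show ?thesis using integrable_bump[OF assms, of x] by simp
qed

lemma integral_moll:
  fixes x :: "'a::euclidean_space"
  assumes "r > 0" shows "(\<integral>y. moll r (x - y) \<partial>lborel) = 1"
proof -
  have "(\<integral>y. moll r (x - y) \<partial>lborel) = (\<integral>y. bump x r y \<partial>lborel) / integral\<^sup>L lborel (bump 0 r :: 'a \<Rightarrow> real)"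
    by (subst moll_commute) (simp add: moll_def bump_minus[of x, abs_def])
  also have "(\<integral>y. bump x r y \<partial>lborel) = (\<integral>y. bump x r (x + y) \<partial>lborel)"
    by (rule integral_lborel_translate[symmetric]) simp
  also have "\<dots> = (\<integral>y. bump (0::'a) r y \<partial>lborel)" by (subst bump_minus) simp
  finally show ?thesis using integral_bump_pos[OF assms, of "0::'a"] by simp
qed

lemma nn_integral_moll:
  fixes y :: "'a::euclidean_space"
  assumes "r > 0" shows "(\<integral>\<^sup>+x. ennreal (moll r (x - y)) \<partial>lborel) = 1"
  using integral_moll[OF assms, of y] integrable_moll[OF assms, of y]
  by (subst moll_commute, subst nn_integral_eq_integral) (auto simp: moll_nonneg)

definition mollify :: "real \<Rightarrow> ('a::euclidean_space \<Rightarrow> 'b::euclidean_space) \<Rightarrow> 'a \<Rightarrow> 'b" where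
  "mollify r f x = (\<integral>y. moll r (x - y) *\<^sub>R f y \<partial>lborel)"

lemma conv_moll: "conv (moll r) U = mollify r U"
  by (simp add: conv_def mollify_def fun_eq_iff)

lemma smooth_on_mollify:
  assumes "r > 0" "continuous_on UNIV U" shows "smooth_on UNIV (mollify r U)"
  unfolding conv_moll[symmetric] using assms
  by (intro smooth_on_conv[where r=r] smooth_on_moll) (use moll_eq_0[of r _ 0] in \<open>auto simp: not_le\<close>)

lemma borel_measurable_mollify [measurable]:
  fixes f :: "'a::euclidean_space \<Rightarrow> 'b::euclidean_space"
  assumes [measurable]: "f \<in> borel_measurable borel"
  shows "mollify r f \<in> borel_measurable borel"
  unfolding mollify_def[abs_def] by measurable

lemma integrable_mollify:
  fixes f :: "'a::euclidean_space \<Rightarrow> 'b::euclidean_space"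
  assumes [measurable]: "f \<in> borel_measurable borel" and "r > 0"
    and "\<And>y. y \<in> cball x r \<Longrightarrow> norm (f y) \<le> C"
  shows "integrable lborel (\<lambda>y. moll r (x - y) *\<^sub>R f y)"
proof (rule Bochner_Integration.integrable_bound)
  show "integrable lborel (\<lambda>y. C * moll r (x - y))" using integrable_moll[OF \<open>r > 0\<close>, of x] by simp
  have "norm (moll r (x - y) *\<^sub>R f y) \<le> norm (C * moll r (x - y))" for y
  proof (cases "dist x y \<le> r")
    case True
    then have "norm (f y) \<le> \<bar>C\<bar>" using assms(3)[of y] by auto
    then show ?thesis by (simp add: abs_mult mult.commute mult_right_mono)
  qed (use \<open>r > 0\<close> in \<open>simp add: moll_eq_0\<close>)
  then show "AE y in lborel. norm (moll r (x - y) *\<^sub>R f y) \<le> norm (C * moll r (x - y))" by simp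
qed measurable

text \<open>Mollification is an average of total weight 1 over a ball of radius r, so it stays as
  close to \<open>a\<close> as the averaged values do. Taking a = 0 gives sup bounds, taking a = f x
  gives pointwise convergence.\<close>

lemma norm_mollify_diff_le:
  fixes f :: "'a::euclidean_space \<Rightarrow> 'b::euclidean_space"
  assumes [measurable]: "f \<in> borel_measurable borel" and "r > 0"
    and e: "\<And>y. y \<in> cball x r \<Longrightarrow> norm (f y - a) \<le> e"
  shows "norm (mollify r f x - a) \<le> e"
proof -
  have "norm (f y) \<le> norm a + e" if "y \<in> cball x r" for y
    using e[OF that] norm_triangle_ineq2[of "f y" a] by linarith
  then have 1: "integrable lborel (\<lambda>y. moll r (x - y) *\<^sub>R f y)"
    by (intro integrable_mollify assms) auto
  have 2: "integrable lborel (\<lambda>y. moll r (x - y) *\<^sub>R (f y - a))"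
    by (intro integrable_mollify[where C=e] assms) auto
  have "mollify r f x - a = (\<integral>y. moll r (x - y) *\<^sub>R f y \<partial>lborel) - (\<integral>y. moll r (x - y) *\<^sub>R a \<partial>lborel)"
    using integral_moll[OF \<open>r > 0\<close>, of x] integrable_moll[OF \<open>r > 0\<close>, of x] by (simp add: mollify_def)
  also have "\<dots> = (\<integral>y. moll r (x - y) *\<^sub>R (f y - a) \<partial>lborel)"
    using integrable_moll[OF \<open>r > 0\<close>, of x] 1
    by (subst Bochner_Integration.integral_diff[symmetric]) (auto simp: scaleR_diff_right)
  also have "norm \<dots> \<le> (\<integral>y. moll r (x - y) * e \<partial>lborel)"
  proof (rule Bochner_Integration.integral_norm_bound_integral[OF 2])
    show "integrable lborel (\<lambda>y. moll r (x - y) * e)" using integrable_moll[OF \<open>r > 0\<close>, of x] by simp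
    show "norm (moll r (x - y) *\<^sub>R (f y - a)) \<le> moll r (x - y) * e" for y
    proof (cases "dist x y \<le> r")
      case True
      then show ?thesis using e[of y] by (simp add: moll_nonneg mult_left_mono)
    qed (use \<open>r > 0\<close> in \<open>simp add: moll_eq_0\<close>)
  qed
  finally show ?thesis using integral_moll[OF \<open>r > 0\<close>, of x] by simp
qed

lemma mollify_tendsto:
  fixes f :: "'a::euclidean_space \<Rightarrow> 'b::euclidean_space"
  assumes f: "continuous_on UNIV f" and r: "\<And>j. r j > 0" "r \<longlonglongrightarrow> 0"
  shows "(\<lambda>j. mollify (r j) f x) \<longlonglongrightarrow> f x"
proof (rule metric_LIMSEQ_I)
  fix e :: real assume "e > 0"
  have "isCont f x" using f by (simp add: continuous_on_eq_continuous_at)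
  then obtain d where d: "d > 0" "\<And>y. dist y x < d \<Longrightarrow> dist (f y) (f x) < e/2"
    using \<open>e > 0\<close> unfolding continuous_at_eps_delta by (metis half_gt_zero)
  obtain N where N: "\<And>j. j \<ge> N \<Longrightarrow> r j < d"
    using order_tendstoD(2)[OF r(2) d(1)] by (auto simp: eventually_sequentially)
  have "dist (mollify (r j) f x) (f x) < e" if "j \<ge> N" for j
  proof -
    have "norm (mollify (r j) f x - f x) \<le> e/2"
      using N[OF that] d(2) f r(1)
      by (intro norm_mollify_diff_le borel_measurable_continuous_onI)
         (auto simp: dist_norm norm_minus_commute less_imp_le)
    then show ?thesis using \<open>e > 0\<close> by (simp add: dist_norm)
  qed
  then show "\<exists>N. \<forall>j\<ge>N. dist (mollify (r j) f x) (f x) < e" by blast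
qed

text \<open>By Tonelli each y contributes \<open>norm (d y)\<close> with total weight at most 1, and
  only points y within r of the ball matter, whence the enlargement by \<open>e\<close>. Nonnegative
  integrals allow the exchange without an integrability check on the product space.\<close>

lemma mollify_L1_bound:
  fixes d :: "'a::euclidean_space \<Rightarrow> 'b::euclidean_space"
  assumes [measurable]: "d \<in> borel_measurable borel" and bd: "\<And>x. norm (d x) \<le> C" and r: "0 < r" "r \<le> e"
  shows "(\<integral>x. indicator (cball z R) x * norm (mollify r d x) \<partial>lborel)
     \<le> (\<integral>x. indicator (cball z (R + e)) x * norm (d x) \<partial>lborel)"
proof -
  let ?K = "cball z R" and ?K' = "cball z (R + e)"
  have bm: "norm (mollify r d x) \<le> C" for x
    using norm_mollify_diff_le[of d r x 0 C] r bd by auto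
  have i: "integrable lborel (\<lambda>x. indicator (cball z s) x * norm (f x))"
    if [measurable]: "f \<in> borel_measurable borel" and "\<And>x. norm (f x) \<le> C" for s and f :: "'a \<Rightarrow> 'b"
    using integrableI_bounded_set_indicator[of "cball z s" lborel "\<lambda>x. norm (f x)" C] that(2)
    by (auto simp: emeasure_cball_less_top)
  have pw: "ennreal (indicator ?K x * norm (mollify r d x)) \<le>
      (\<integral>\<^sup>+y. ennreal (moll r (x - y)) * ennreal (indicator ?K' y * norm (d y)) \<partial>lborel)" for x
  proof (cases "x \<in> ?K")
    case True
    have "ennreal (norm (mollify r d x)) \<le> (\<integral>\<^sup>+y. ennreal (norm (moll r (x - y) *\<^sub>R d y)) \<partial>lborel)"
      unfolding mollify_def using r bd by (intro integral_norm_bound_ennreal integrable_mollify) auto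
    also have "\<dots> = (\<integral>\<^sup>+y. ennreal (moll r (x - y)) * ennreal (indicator ?K' y * norm (d y)) \<partial>lborel)"
    proof (rule nn_integral_cong)
      fix y
      show "ennreal (norm (moll r (x - y) *\<^sub>R d y)) = ennreal (moll r (x - y)) * ennreal (indicator ?K' y * norm (d y))"
      proof (cases "dist x y \<le> r")
        case True
        then have "y \<in> ?K'" using \<open>x \<in> ?K\<close> r dist_triangle[of z y x] by auto
        then show ?thesis by (simp add: moll_nonneg ennreal_mult')
      qed (use r in \<open>simp add: moll_eq_0\<close>)
    qed
    finally show ?thesis using True by simp
  qed simp
  define G where "G y = ennreal (indicator ?K' y * norm (d y))" for y
  have [measurable]: "G \<in> borel_measurable borel" unfolding G_def[abs_def]
    by (intro measurable_compose[OF _ measurable_ennreal] borel_measurable_times borel_measurable_indicator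
        borel_measurable_norm assms) auto
  have "(\<integral>\<^sup>+x. ennreal (indicator ?K x * norm (mollify r d x)) \<partial>lborel) \<le>
      (\<integral>\<^sup>+x. (\<integral>\<^sup>+y. ennreal (moll r (x - y)) * G y \<partial>lborel) \<partial>lborel)"
    unfolding G_def by (intro nn_integral_mono pw)
  also have "\<dots> = (\<integral>\<^sup>+y. (\<integral>\<^sup>+x. ennreal (moll r (x - y)) * G y \<partial>lborel) \<partial>lborel)"
    by (rule lborel_pair.Fubini') measurable
  also have "\<dots> = (\<integral>\<^sup>+y. ennreal (indicator ?K' y * norm (d y)) \<partial>lborel)"
    using r by (simp add: nn_integral_multc nn_integral_moll G_def)
  finally show ?thesis
    using i[of "mollify r d" R] i[of d "R + e"] bd bm
    by (subst (asm) (1 2) nn_integral_eq_integral) (auto intro: integral_nonneg)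
qed

section \<open>Convergence of mollified bounded measurable functions\<close>

lemma AE_lborel_not_in_negligible: "negligible N \<Longrightarrow> AE x in lborel. x \<notin> N"
proof -
  assume "negligible N"
  then have "N \<in> null_sets (completion lborel)" by (simp add: negligible_iff_null_sets)
  then have "AE x in completion lborel. x \<notin> N" by (rule AE_not_in)
  then show ?thesis by (simp add: AE_completion_iff)
qed

text \<open>Measurable functions are almost everywhere limits of continuous ones. Composing with the
  nearest-point projection onto the ball of radius C enforces the uniform bound; it is continuous
  and fixes the values of \<open>g\<close>, so the limit is unchanged.\<close>

lemma bounded_borel_approx_continuous:
  fixes g :: "'a::euclidean_space \<Rightarrow> 'b::euclidean_space"
  assumes g: "g \<in> borel_measurable borel" "\<And>x. norm (g x) \<le> C"
  obtains c where "\<And>n. continuous_on UNIV (c n)" "\<And>n x. norm (c n x) \<le> C"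
    "AE x in lborel. (\<lambda>n. c n x) \<longlonglongrightarrow> g x"
proof -
  have C: "C \<ge> 0" using g(2)[of 0] norm_ge_zero order_trans by blast
  have "g \<in> borel_measurable lebesgue" using g(1) by (simp add: measurable_completion)
  then have "g measurable_on UNIV" by (intro lebesgue_measurable_imp_measurable_on) auto
  then obtain N h where N: "negligible N" and h: "\<And>n. continuous_on UNIV (h n)"
      "\<And>x. x \<notin> N \<Longrightarrow> (\<lambda>n. h n x) \<longlonglongrightarrow> g x"
    unfolding measurable_on_def by auto
  let ?p = "closest_point (cball 0 C :: 'b set)"
  have p: "continuous_on UNIV ?p" using C by (intro continuous_on_closest_point) auto
  show ?thesis
  proof (rule that[of "\<lambda>n x. ?p (h n x)"])
    show "continuous_on UNIV (\<lambda>x. ?p (h n x))" for n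
      by (rule continuous_on_compose2[OF p h(1)]) auto
    show "norm (?p (h n x)) \<le> C" for n x
      using closest_point_in_set[of "cball 0 C" "h n x"] C by auto
    have "(\<lambda>n. ?p (h n x)) \<longlonglongrightarrow> g x" if "x \<notin> N" for x
    proof -
      have "isCont ?p (g x)" using p by (simp add: continuous_on_eq_continuous_at)
      from isCont_tendsto_compose[OF this h(2)[OF that]]
      show ?thesis using g(2) by (simp add: closest_point_self)
    qed
    then show "AE x in lborel. (\<lambda>n. ?p (h n x)) \<longlonglongrightarrow> g x"
      using AE_lborel_not_in_negligible[OF N] by (auto elim: eventually_mono)
  qed
qed

lemma integrable_cball_bounded:
  fixes f :: "'a::euclidean_space \<Rightarrow> 'b::euclidean_space"
  assumes "f \<in> borel_measurable borel" "\<And>x. x \<in> cball z s \<Longrightarrow> norm (f x) \<le> C"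
  shows "integrable lborel (\<lambda>x. indicator (cball z s) x *\<^sub>R f x)"
  using assms by (intro integrableI_bounded_set_indicator[where B=C]) (auto simp: emeasure_cball_less_top)

lemma integrable_cball_support:
  fixes f :: "'a::euclidean_space \<Rightarrow> 'b::euclidean_space"
  assumes "f \<in> borel_measurable borel" "\<And>x. x \<in> cball z s \<Longrightarrow> norm (f x) \<le> C"
    "\<And>x. x \<notin> cball z s \<Longrightarrow> f x = 0"
  shows "integrable lborel f"
proof -
  have "(\<lambda>x. indicator (cball z s) x *\<^sub>R f x) = f" using assms(3) by (auto simp: indicator_def)
  then show ?thesis using integrable_cball_bounded[OF assms(1,2), of z s] by simp
qed

lemma integral_cball_tendsto:
  fixes f :: "nat \<Rightarrow> 'a::euclidean_space \<Rightarrow> real"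
  assumes [measurable]: "\<And>n. f n \<in> borel_measurable borel" "f' \<in> borel_measurable borel"
    and bd: "\<And>n x. x \<in> cball z s \<Longrightarrow> norm (f n x) \<le> C"
    and 0: "\<And>n x. x \<notin> cball z s \<Longrightarrow> f n x = 0" "\<And>x. x \<notin> cball z s \<Longrightarrow> f' x = 0"
    and lim: "AE x in lborel. x \<in> cball z s \<longrightarrow> (\<lambda>n. f n x) \<longlonglongrightarrow> f' x"
  shows "(\<lambda>n. integral\<^sup>L lborel (f n)) \<longlonglongrightarrow> integral\<^sup>L lborel f'"
proof (rule integral_dominated_convergence[where w="\<lambda>x. indicator (cball z s) x *\<^sub>R C"])
  show "integrable lborel (\<lambda>x::'a. indicator (cball z s) x *\<^sub>R C)"
    by (intro integrable_cball_bounded[where C="\<bar>C\<bar>"]) auto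
  show "AE x in lborel. (\<lambda>n. f n x) \<longlonglongrightarrow> f' x"
    using lim
  proof eventually_elim
    case (elim x)
    then show ?case by (cases "x \<in> cball z s") (simp_all add: 0)
  qed
  show "AE x in lborel. norm (f n x) \<le> indicator (cball z s) x *\<^sub>R C" for n
  proof (rule AE_I2)
    fix x show "norm (f n x) \<le> indicator (cball z s) x *\<^sub>R C"
      using bd[of x n] 0(1)[of x n] by (cases "x \<in> cball z s") auto
  qed
qed measurable

lemma integral_cball_tendsto_0:
  fixes f :: "nat \<Rightarrow> 'a::euclidean_space \<Rightarrow> real"
  assumes "\<And>n. f n \<in> borel_measurable borel" "\<And>n x. x \<in> cball z s \<Longrightarrow> norm (f n x) \<le> C"
    and "AE x in lborel. (\<lambda>n. f n x) \<longlonglongrightarrow> 0"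
  shows "(\<lambda>n. \<integral>x. indicator (cball z s) x * f n x \<partial>lborel) \<longlonglongrightarrow> 0"
proof -
  have "(\<lambda>n. \<integral>x. indicator (cball z s) x * f n x \<partial>lborel) \<longlonglongrightarrow> (\<integral>x. 0 \<partial>(lborel :: 'a measure))"
  proof (rule integral_cball_tendsto[where z=z and s=s and C=C])
    show "(\<lambda>x. indicator (cball z s) x * f n x) \<in> borel_measurable borel" for n
      by (intro borel_measurable_times borel_measurable_indicator assms) auto
    show "AE x in lborel. x \<in> cball z s \<longrightarrow> (\<lambda>n. indicator (cball z s) x * f n x) \<longlonglongrightarrow> 0"
      using assms(3) by eventually_elim simp
  qed (use assms(2) in auto)
  then show ?thesis by simp
qed

text \<open>Three-epsilon argument: split \<open>g\<close> into a continuous bounded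
  \<open>c n\<close> and a remainder that is small in L1 on the enlarged ball. Mollification does
  not increase the remainder, up to enlarging the ball, and the continuous part converges pointwise
  and boundedly.\<close>

lemma mollify_L1_tendsto:
  fixes g :: "'a::euclidean_space \<Rightarrow> 'b::euclidean_space"
  assumes g [measurable]: "g \<in> borel_measurable borel" and M: "\<And>x. norm (g x) \<le> M"
    and r: "\<And>j. 0 < r j" "\<And>j. r j \<le> e" "r \<longlonglongrightarrow> 0"
  shows "(\<lambda>j. \<integral>x. indicator (cball z R) x * norm (mollify (r j) g x - g x) \<partial>lborel) \<longlonglongrightarrow> 0"
proof -
  let ?K = "cball z R" and ?K' = "cball z (R + e)"
  have "e > 0" using r(1,2) by (meson less_le_trans)
  obtain c where c: "\<And>n. continuous_on UNIV (c n)" "\<And>n x. norm (c n x) \<le> M"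
    "AE x in lborel. (\<lambda>n. c n x) \<longlonglongrightarrow> g x"
    using bounded_borel_approx_continuous[OF g M] by blast
  have [measurable]: "c n \<in> borel_measurable borel" for n
    using c(1) by (rule borel_measurable_continuous_onI)
  have mM: "norm (mollify (r j) f x) \<le> C" if "f \<in> borel_measurable borel" "\<And>x. norm (f x) \<le> C"
    for j x C and f :: "'a \<Rightarrow> 'b"
    using norm_mollify_diff_le[of f "r j" x 0 C] r that by auto
  have mc: "norm (mollify (r j) (c n) x) \<le> M" for j n x
    by (rule mM) (auto intro: c(2))
  have b: "(\<lambda>n. \<integral>x. indicator ?K' x * norm (g x - c n x) \<partial>lborel) \<longlonglongrightarrow> 0"
  proof (rule integral_cball_tendsto_0[where C="M + M"])
    show "norm (norm (g x - c n x)) \<le> M + M" for n x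
      using norm_triangle_ineq4[of "g x" "c n x"] M[of x] c(2)[of n x] by simp
    show "AE x in lborel. (\<lambda>n. norm (g x - c n x)) \<longlonglongrightarrow> 0"
      using c(3)
    proof eventually_elim
      case (elim x)
      then show ?case using tendsto_norm_zero[OF LIM_zero[OF elim]] by (simp add: norm_minus_commute)
    qed
  qed measurable
  show ?thesis
  proof (rule metric_LIMSEQ_I)
    fix \<epsilon> :: real assume "\<epsilon> > 0"
    obtain n where n: "(\<integral>x. indicator ?K' x * norm (g x - c n x) \<partial>lborel) < \<epsilon>/3"
      using order_tendstoD(2)[OF b, of "\<epsilon>/3"] \<open>\<epsilon> > 0\<close> by (auto simp: eventually_sequentially)
    define d where "d x = g x - c n x" for x
    have dm [measurable]: "d \<in> borel_measurable borel" unfolding d_def[abs_def] by measurable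
    have dM: "norm (d x) \<le> M + M" for x
      using norm_triangle_ineq4[of "g x" "c n x"] M[of x] c(2)[of n x] by (simp add: d_def)
    have q: "(\<lambda>j. \<integral>x. indicator ?K x * norm (mollify (r j) (c n) x - c n x) \<partial>lborel) \<longlonglongrightarrow> 0"
    proof (rule integral_cball_tendsto_0[where C="M + M"])
      show "norm (norm (mollify (r j) (c n) x - c n x)) \<le> M + M" for j x
        using norm_triangle_ineq4[of "mollify (r j) (c n) x" "c n x"] mc[of j n x] c(2)[of n x] by simp
      have "(\<lambda>j. norm (mollify (r j) (c n) x - c n x)) \<longlonglongrightarrow> 0" for x
        using mollify_tendsto[OF c(1) r(1,3), of n x] by (simp add: tendsto_norm_zero LIM_zero)
      then show "AE x in lborel. (\<lambda>j. norm (mollify (r j) (c n) x - c n x)) \<longlonglongrightarrow> 0" by simp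
    qed measurable
    obtain N where N: "\<And>j. j \<ge> N \<Longrightarrow> (\<integral>x. indicator ?K x * norm (mollify (r j) (c n) x - c n x) \<partial>lborel) < \<epsilon>/3"
      using order_tendstoD(2)[OF q, of "\<epsilon>/3"] \<open>\<epsilon> > 0\<close> by (auto simp: eventually_sequentially)
    have "dist (\<integral>x. indicator ?K x * norm (mollify (r j) g x - g x) \<partial>lborel) 0 < \<epsilon>" if "j \<ge> N" for j
    proof -
      have split: "mollify (r j) g x = mollify (r j) d x + mollify (r j) (c n) x" for x
      proof -
        have "mollify (r j) d x + mollify (r j) (c n) x =
          (\<integral>y. moll (r j) (x - y) *\<^sub>R d y + moll (r j) (x - y) *\<^sub>R c n y \<partial>lborel)"
          unfolding mollify_def
          by (intro Bochner_Integration.integral_add[symmetric]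
                integrable_mollify[where f=d and C="M + M"] integrable_mollify[where f="c n" and C=M])
             (use dM c(2) r(1) in auto)
        also have "\<dots> = mollify (r j) g x"
          by (simp add: mollify_def d_def flip: scaleR_add_right)
        finally show ?thesis by simp
      qed
      have I: "integrable lborel (\<lambda>x. indicator (cball z s) x * f x)"
        if "f \<in> borel_measurable borel" "\<And>x. norm (f x) \<le> C" for s C and f :: "'a \<Rightarrow> real"
        using integrable_cball_bounded[of f z s C] that by simp
      have i1: "integrable lborel (\<lambda>x. indicator ?K x * norm (mollify (r j) d x))"
        using mM[OF dm dM] by (intro I[where C="M + M"]) auto
      have "norm (mollify (r j) (c n) x - c n x) \<le> M + M" for x
        using norm_triangle_ineq4[of "mollify (r j) (c n) x" "c n x"] mc[of j n x] c(2)[of n x] by simp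
      then have i2: "integrable lborel (\<lambda>x. indicator ?K x * norm (mollify (r j) (c n) x - c n x))"
        by (intro I[where C="M + M"]) auto
      have i3: "integrable lborel (\<lambda>x. indicator ?K' x * norm (d x))"
        using dM by (intro I[where C="M + M"]) auto
      have "(\<integral>x. indicator ?K x * norm (mollify (r j) g x - g x) \<partial>lborel)
        \<le> (\<integral>x. (indicator ?K x * norm (mollify (r j) d x) + indicator ?K x * norm (mollify (r j) (c n) x - c n x))
            + indicator ?K' x * norm (d x) \<partial>lborel)"
      proof (rule integral_mono')
        show "indicator ?K x * norm (mollify (r j) g x - g x) \<le>
          indicator ?K x * norm (mollify (r j) d x) + indicator ?K x * norm (mollify (r j) (c n) x - c n x)
            + indicator ?K' x * norm (d x)" for x
        proof (cases "x \<in> ?K")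
          case True
          have "mollify (r j) g x - g x = mollify (r j) d x + (mollify (r j) (c n) x - c n x) - d x"
            by (simp add: split d_def)
          then have "norm (mollify (r j) g x - g x) \<le> norm (mollify (r j) d x) + norm (mollify (r j) (c n) x - c n x) + norm (d x)"
            by (metis (no_types, lifting) add_right_mono norm_triangle_ineq norm_triangle_le_diff)
          then show ?thesis using True \<open>e > 0\<close> by auto
        qed simp
      qed (use i1 i2 i3 in auto)
      also have "\<dots> = (\<integral>x. indicator ?K x * norm (mollify (r j) d x) \<partial>lborel)
          + (\<integral>x. indicator ?K x * norm (mollify (r j) (c n) x - c n x) \<partial>lborel)
          + (\<integral>x. indicator ?K' x * norm (d x) \<partial>lborel)"
        using i1 i2 i3 by simp
      also have "\<dots> < \<epsilon>/3 + \<epsilon>/3 + \<epsilon>/3"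
        using mollify_L1_bound[OF dm dM r(1,2)[of j], of z R] N[OF that] n unfolding d_def by linarith
      finally show ?thesis by (simp add: dist_norm abs_of_nonneg integral_nonneg)
    qed
    then show "\<exists>N. \<forall>j\<ge>N. dist (\<integral>x. indicator ?K x * norm (mollify (r j) g x - g x) \<partial>lborel) 0 < \<epsilon>" by blast
  qed
qed

section \<open>Test functions, Young's inequality and translations\<close>

lemma continuous_bounded_on_cball:
  fixes f :: "'a::euclidean_space \<Rightarrow> 'b::euclidean_space"
  assumes "continuous_on UNIV f"
  obtains B where "B \<ge> 0" "\<And>x. x \<in> cball z R \<Longrightarrow> norm (f x) \<le> B"
proof -
  have "bounded (f ` cball z R)"
    using assms by (intro compact_imp_bounded compact_continuous_image) (auto intro: continuous_on_subset)
  then obtain B where "B > 0" "\<And>y. y \<in> f ` cball z R \<Longrightarrow> norm y \<le> B" unfolding bounded_pos by blast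
  then show ?thesis by (intro that[of B]) auto
qed

lemma test_functionsI:
  fixes \<psi> :: "'a::euclidean_space \<Rightarrow> real"
  assumes "smooth_on UNIV \<psi>" "\<And>x. x \<notin> cball z R \<Longrightarrow> \<psi> x = 0" "cball z R \<subseteq> \<Omega>"
  shows "\<psi> \<in> test_functions \<Omega>"
proof -
  have "{x. \<psi> x \<noteq> 0} \<subseteq> cball z R" using assms(2) by blast
  then have 1: "closure {x. \<psi> x \<noteq> 0} \<subseteq> cball z R" by (rule closure_minimal) simp
  then have 2: "compact (closure {x. \<psi> x \<noteq> 0})"
    using compact_Int_closed[OF compact_cball closed_closure] by (metis inf.absorb2)
  from assms(1,3) 1 2 show ?thesis unfolding test_functions_def by blast
qed

lemma gradient_eqI:
  assumes "smooth_on UNIV f" "(f has_derivative (\<lambda>v. a \<bullet> v)) (at x)"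
  shows "gradient f x = a"
  using frechet_derivative_eqI[OF assms(2)] gradient_inner[OF assms(1), of x] vector_eq_rdot
  by (metis (no_types, lifting))

lemma has_derivative_gradient:
  assumes "smooth_on UNIV f" shows "(f has_derivative (\<lambda>v. gradient f x \<bullet> v)) (at x)"
  using smooth_on_has_derivative[OF assms] by (simp add: gradient_inner[OF assms])

lemma gradient_eq_0_outside:
  assumes "smooth_on UNIV f" "closed K" "\<And>x. x \<notin> K \<Longrightarrow> f x = 0" "x \<notin> K"
  shows "gradient f x = 0"
proof (rule gradient_eqI[OF assms(1)])
  show "(f has_derivative (\<lambda>v. 0 \<bullet> v)) (at x)"
    by (rule has_derivative_transform_within_open[of "\<lambda>x. 0" _ _ _ "- K"]) (use assms in auto)
qed

text \<open>Young's inequality with an explicit constant. Below the threshold X = (2B)^p the power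
  of X is bounded by (2B)^(p-1); above it, B is at most X^(1/p) / 2.\<close>

lemma mult_powr_absorb:
  fixes B X p :: real
  assumes "B > 0" "X \<ge> 0" "p \<ge> 1"
  shows "B * X powr (1 - 1/p) \<le> X/2 + (2*B) powr p"
proof (cases "X \<le> (2*B) powr p")
  case True
  have "X powr (1 - 1/p) \<le> ((2*B) powr p) powr (1 - 1/p)"
    using True assms by (intro powr_mono2) auto
  also have "\<dots> = (2*B) powr (p - 1)" using assms by (simp add: powr_powr right_diff_distrib)
  finally have "B * X powr (1 - 1/p) \<le> B * (2*B) powr (p - 1)" using assms by simp
  also have "\<dots> = (2*B) powr p / 2" using assms by (simp add: powr_diff)
  also have "\<dots> \<le> (2*B) powr p" by simp
  finally show ?thesis using assms by linarith
next
  case False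
  then have "X > 0" using assms by (smt (verit) powr_ge_zero)
  have "2*B = ((2*B) powr p) powr (1/p)" using assms by (simp add: powr_powr)
  also have "\<dots> \<le> X powr (1/p)" using False assms by (intro powr_mono2) auto
  finally have "B * X powr (1 - 1/p) \<le> X powr (1/p) / 2 * X powr (1 - 1/p)"
    by (intro mult_right_mono) auto
  also have "\<dots> = X / 2" using \<open>X > 0\<close> by (simp flip: powr_add)
  finally show ?thesis by (smt (verit) powr_ge_zero)
qed

text \<open>Fundamental theorem of calculus along the segment from x to x + h, which stays in the
  ball by convexity. After exchanging the integrals, translation invariance makes the inner integral
  independent of the position t on the segment.\<close>

lemma integral_translate_diff_le:
  fixes W :: "'a::euclidean_space \<Rightarrow> real"
  assumes W: "\<And>x. (W has_derivative (\<lambda>v. G x \<bullet> v)) (at x)" and G: "continuous_on UNIV G"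
    and S [measurable]: "S \<in> sets borel" and SK: "S \<subseteq> cball z R" "\<And>x. x \<in> S \<Longrightarrow> x + h \<in> cball z R"
  shows "(\<integral>x. indicator S x * (W (x + h) - W x) \<partial>lborel)
      \<le> norm h * (\<integral>x. indicator (cball z R) x * norm (G x) \<partial>lborel)"
proof -
  let ?K = "cball z R"
  define H where "H y = ennreal (indicator ?K y * norm (G y))" for y
  have [measurable]: "G \<in> borel_measurable borel" using G by (rule borel_measurable_continuous_onI)
  have [measurable]: "W \<in> borel_measurable borel"
    using has_derivative_continuous[OF W]
    by (intro borel_measurable_continuous_onI) (simp add: continuous_on_eq_continuous_at)
  have [measurable]: "H \<in> borel_measurable borel" unfolding H_def[abs_def]
    by (intro measurable_compose[OF _ measurable_ennreal] borel_measurable_times borel_measurable_indicator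
        borel_measurable_norm) auto
  \<comment> \<open>\<open>ennreal\<close> sends negative increments to 0, which does no harm to an
    upper bound.\<close>
  have pw: "ennreal (indicator S x * (W (x + h) - W x)) \<le>
      (\<integral>\<^sup>+t. ennreal (norm h) * (indicator {0..1::real} t * H (t *\<^sub>R h + x)) \<partial>lborel)" for x
  proof (cases "x \<in> S")
    case True
    let ?f = "\<lambda>t. G (x + t *\<^sub>R h) \<bullet> h"
    have "has_bochner_integral lborel (\<lambda>t. indicator {0..1} t *\<^sub>R ?f t) (W (x + 1 *\<^sub>R h) - W (x + 0 *\<^sub>R h))"
    proof (rule has_bochner_integral_FTC_Icc)
      fix t :: real
      have "((\<lambda>t. x + t *\<^sub>R h) has_derivative (\<lambda>s. s *\<^sub>R h)) (at t within {0..1})"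
        by (auto intro!: derivative_eq_intros)
      from has_derivative_compose[OF this W]
      show "((\<lambda>t. W (x + t *\<^sub>R h)) has_vector_derivative ?f t) (at t within {0..1})"
        by (simp add: has_vector_derivative_def)
    next
      show "continuous_on {0..1} ?f"
        by (intro continuous_intros continuous_on_compose2[OF G]) auto
    qed simp
    then have i: "integrable lborel (\<lambda>t. indicator {0..1} t *\<^sub>R ?f t)"
      and eq: "W (x + h) - W x = (\<integral>t. indicator {0..1} t *\<^sub>R ?f t \<partial>lborel)"
      by (auto simp: has_bochner_integral_iff)
    have "ennreal (W (x + h) - W x) \<le> ennreal (norm (\<integral>t. indicator {0..1} t *\<^sub>R ?f t \<partial>lborel))"
      unfolding eq by (intro ennreal_leI) simp
    also have "\<dots> \<le> (\<integral>\<^sup>+t. ennreal (norm (indicator {0..1} t *\<^sub>R ?f t)) \<partial>lborel)"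
      by (rule integral_norm_bound_ennreal[OF i])
    also have "\<dots> \<le> (\<integral>\<^sup>+t. ennreal (norm h) * (indicator {0..1::real} t * H (t *\<^sub>R h + x)) \<partial>lborel)"
    proof (rule nn_integral_mono)
      fix t :: real
      show "ennreal (norm (indicator {0..1} t *\<^sub>R ?f t)) \<le> ennreal (norm h) * (indicator {0..1::real} t * H (t *\<^sub>R h + x))"
      proof (cases "t \<in> {0..1}")
        case t: True
        have "(1 - t) *\<^sub>R x + t *\<^sub>R (x + h) \<in> ?K"
          using convexD[OF convex_cball, of x z R "x + h" "1 - t" t] True SK t by auto
        then have "t *\<^sub>R h + x \<in> ?K" by (simp add: algebra_simps)
        moreover have "\<bar>?f t\<bar> \<le> norm h * norm (G (t *\<^sub>R h + x))"
          using Cauchy_Schwarz_ineq2[of "G (x + t *\<^sub>R h)" h] by (simp add: mult.commute add.commute)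
        ultimately show ?thesis using t by (simp add: H_def ennreal_mult[symmetric] ennreal_leI)
      qed simp
    qed
    finally show ?thesis using True by simp
  qed simp
  have "(\<integral>\<^sup>+x. ennreal (indicator S x * (W (x + h) - W x)) \<partial>lborel) \<le>
     (\<integral>\<^sup>+x. (\<integral>\<^sup>+t. ennreal (norm h) * (indicator {0..1::real} t * H (t *\<^sub>R h + x)) \<partial>lborel) \<partial>lborel)"
    by (intro nn_integral_mono pw)
  also have "\<dots> = (\<integral>\<^sup>+t. (\<integral>\<^sup>+x. ennreal (norm h) * (indicator {0..1::real} t * H (t *\<^sub>R h + x)) \<partial>lborel) \<partial>lborel)"
    by (rule lborel_pair.Fubini') measurable
  also have "\<dots> = (\<integral>\<^sup>+t. ennreal (norm h) * (indicator {0..1::real} t * integral\<^sup>N lborel H) \<partial>lborel)"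
    by (simp add: nn_integral_cmult nn_integral_lborel_translate)
  also have "\<dots> = ennreal (norm h) * integral\<^sup>N lborel H"
    by (simp add: nn_integral_cmult nn_integral_multc)
  also have "integral\<^sup>N lborel H = ennreal (\<integral>x. indicator ?K x * norm (G x) \<partial>lborel)"
    unfolding H_def using borel_integrable_compact[OF compact_cball continuous_on_subset[OF continuous_on_norm[OF G]], of z R]
    by (intro nn_integral_eq_integral) auto
  finally show ?thesis
    by (intro integral_real_bounded) (auto simp: ennreal_mult integral_nonneg)
qed

section \<open>Energy estimates\<close>

lemma abs_inner_le:
  assumes "norm a \<le> \<alpha>" "norm v \<le> \<beta>" shows "\<bar>a \<bullet> v\<bar> \<le> \<alpha> * \<beta>"
  using Cauchy_Schwarz_ineq2[of a v] mult_mono[OF assms order_trans[OF norm_ge_zero assms(1)] norm_ge_zero]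
  by linarith

lemma powr_shift_le:
  fixes t \<epsilon> s :: real
  assumes "t \<ge> 0" "\<epsilon> > 0" "s \<le> 0" shows "(t + \<epsilon>) powr s \<le> \<epsilon> powr s"
  using assms by (intro powr_mono2') auto

text \<open>The problem after passing to representatives: \<open>U\<close>, \<open>F\<close> and
  \<open>g\<close> are total functions, regular or bounded everywhere, and all integrals are over
  the whole space. \<open>F\<close> stands for f(u) and enters through its lower bound, so the
  estimates make sense on any domain.\<close>

locale p_laplace_core =
  fixes \<Omega> :: "'a::euclidean_space set" and p M c :: real
    and U F :: "'a \<Rightarrow> real" and g :: "'a \<Rightarrow> 'a"
  assumes p: "p \<ge> 2"
    and U: "continuous_on UNIV U" "\<And>x. U x \<ge> 0"
    and g [measurable]: "g \<in> borel_measurable borel" and gM: "\<And>x. norm (g x) \<le> M"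
    and F: "continuous_on UNIV F" and c: "c > 0" and F_ge: "\<And>x. F x \<ge> c * U x powr (p - 1)"
    and weak_grad: "\<And>\<psi>. \<psi> \<in> test_functions \<Omega> \<Longrightarrow>
      (\<integral>x. U x *\<^sub>R gradient \<psi> x \<partial>lborel) = - (\<integral>x. \<psi> x *\<^sub>R g x \<partial>lborel)"
    and weak_eq: "\<And>\<psi>. \<psi> \<in> test_functions \<Omega> \<Longrightarrow>
      (\<integral>x. (norm (g x) powr (p - 2) *\<^sub>R g x) \<bullet> gradient \<psi> x \<partial>lborel) = (\<integral>x. F x * \<psi> x \<partial>lborel)"
begin

lemma U_borel [measurable]: "U \<in> borel_measurable borel"
  using U(1) by (rule borel_measurable_continuous_onI)

lemma F_borel [measurable]: "F \<in> borel_measurable borel"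
  using F by (rule borel_measurable_continuous_onI)

lemma F_nonneg: "F x \<ge> 0"
  using F_ge[of x] c by (smt (verit) mult_nonneg_nonneg powr_ge_zero)

text \<open>The kernel y \<mapsto> moll r (x - y) is itself an admissible test function once its
  ball lies in \<Omega>. The sign from differentiating x - y in y cancels the one in the definition
  of the weak gradient.\<close>

lemma gradient_mollify:
  assumes r: "r > 0" "cball x r \<subseteq> \<Omega>"
  shows "gradient (mollify r U) x = mollify r g x"
proof (rule gradient_eqI)
  show "smooth_on UNIV (mollify r U)" using r U by (intro smooth_on_mollify)
  define \<psi> where "\<psi> y = moll r (x - y)" for y
  have \<psi>b: "\<psi> = (\<lambda>y. inverse (integral\<^sup>L lborel (bump 0 r :: 'a \<Rightarrow> real)) * bump x r y)"
    unfolding \<psi>_def by (subst moll_commute) (simp add: moll_def bump_minus[of x, abs_def] field_simps)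
  have \<psi>s: "smooth_on UNIV \<psi>" unfolding \<psi>b by (intro smooth_on_mult smooth_on_const smooth_on_bump)
  have \<psi>0: "\<psi> y = 0" if "y \<notin> cball x r" for y
    using that r by (auto simp: \<psi>_def intro!: moll_eq_0)
  have \<psi>t: "\<psi> \<in> test_functions \<Omega>" by (rule test_functionsI[OF \<psi>s \<psi>0 r(2)])
  have d: "gradient \<psi> y \<bullet> v = - frechet_derivative (moll r) (at (x - y)) v" for y v
  proof -
    have "((\<lambda>y. x - y) has_derivative (\<lambda>v. - v)) (at y)" by (auto intro!: derivative_eq_intros)
    from has_derivative_compose[OF this smooth_on_has_derivative[OF smooth_on_moll]]
    have "(\<psi> has_derivative (\<lambda>v. frechet_derivative (moll r) (at (x - y)) (- v))) (at y)"
      by (simp add: \<psi>_def[abs_def])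
    moreover have "linear (frechet_derivative (moll r) (at (x - y)))"
      using smooth_on_has_derivative[OF smooth_on_moll] has_derivative_linear by blast
    ultimately show ?thesis
      by (simp add: gradient_inner[OF \<psi>s] frechet_derivative_eqI linear_neg)
  qed
  have i1: "integrable lborel (\<lambda>y. U y *\<^sub>R gradient \<psi> y)"
    by (rule integrable_continuous_compact_support[of _ "cball x r"])
       (auto intro!: continuous_intros U continuous_on_gradient \<psi>s gradient_eq_0_outside[OF \<psi>s closed_cball \<psi>0])
  have i2: "integrable lborel (\<lambda>y. \<psi> y *\<^sub>R g y)"
    unfolding \<psi>_def using r gM by (intro integrable_mollify) auto
  have "conv (\<lambda>x. frechet_derivative (moll r) (at x) v) U x = mollify r g x \<bullet> v" for v
  proof -
    have "conv (\<lambda>x. frechet_derivative (moll r) (at x) v) U x = - (\<integral>y. (U y *\<^sub>R gradient \<psi> y) \<bullet> v \<partial>lborel)"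
      by (simp add: conv_def d mult.commute)
    also have "\<dots> = - ((\<integral>y. U y *\<^sub>R gradient \<psi> y \<partial>lborel) \<bullet> v)"
      using i1 by (subst integral_inner_left) auto
    also have "\<dots> = (\<integral>y. \<psi> y *\<^sub>R g y \<partial>lborel) \<bullet> v" by (simp add: weak_grad[OF \<psi>t])
    finally show ?thesis by (simp add: mollify_def \<psi>_def)
  qed
  then show "(mollify r U has_derivative (\<lambda>v. mollify r g x \<bullet> v)) (at x)"
    using conv_has_derivative[OF smooth_on_moll, of r r U x] moll_eq_0[OF r(1), of _ 0] U(1)
    by (auto simp: conv_moll not_le)
qed

text \<open>The mollified gradients converge in L1 only, so a subsequence is chosen to get
  convergence almost everywhere. The margin \<open>e\<close> keeps all mollification balls inside
  \<Omega>; averaging preserves nonnegativity and the bound \<open>M\<close>.\<close>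

lemma smooth_approximation:
  assumes e: "e > 0" "cball z (R + e) \<subseteq> \<Omega>"
  obtains w D where "\<And>j. smooth_on UNIV (w j)" "\<And>j x. w j x \<ge> 0" "\<And>x. (\<lambda>j. w j x) \<longlonglongrightarrow> U x"
    "\<And>j x. x \<in> cball z R \<Longrightarrow> norm (gradient (w j) x) \<le> M"
    "AE x in lborel. x \<in> cball z R \<longrightarrow> (\<lambda>j. gradient (w j) x) \<longlonglongrightarrow> g x"
    "\<And>j x. x \<in> cball z R \<Longrightarrow> w j x \<le> D"
proof -
  define r where "r j = e / real (Suc j)" for j
  have r: "r j > 0" "r j \<le> e" for j using e by (auto simp: r_def field_simps)
  have r0: "r \<longlonglongrightarrow> 0" unfolding r_def by (rule LIMSEQ_Suc[OF lim_const_over_n])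
  have mM: "norm (mollify (r j) g x) \<le> M" for j x
    using norm_mollify_diff_le[of g "r j" x 0 M] r gM by auto
  let ?u = "\<lambda>j x. indicator (cball z R) x *\<^sub>R (mollify (r j) g x - g x)"
  have "\<exists>s::nat\<Rightarrow>nat. strict_mono s \<and> (AE x in lborel. (\<lambda>j. ?u (s j) x) \<longlonglongrightarrow> 0)"
  proof (rule tendsto_L1_AE_subseq)
    show "integrable lborel (?u j)" for j
    proof (rule integrable_cball_bounded[where C="M + M"])
      show "norm (mollify (r j) g x - g x) \<le> M + M" for x
        using norm_triangle_ineq4[of "mollify (r j) g x" "g x"] mM[of j x] gM[of x] by linarith
    qed measurable
    have "norm (?u j x) = indicator (cball z R) x * norm (mollify (r j) g x - g x)" for j x by simp
    then show "(\<lambda>j. \<integral>x. norm (?u j x) \<partial>lborel) \<longlonglongrightarrow> 0"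
      using mollify_L1_tendsto[OF g gM r r0, of z R] by presburger
  qed
  then obtain s :: "nat \<Rightarrow> nat" where s: "strict_mono s" "AE x in lborel. (\<lambda>j. ?u (s j) x) \<longlonglongrightarrow> 0"
    by blast
  have sub: "cball x (r j) \<subseteq> cball z (R + e)" if "x \<in> cball z R" for j x
  proof
    fix y assume "y \<in> cball x (r j)"
    then show "y \<in> cball z (R + e)" using that r(2)[of j] dist_triangle[of z y x] by simp
  qed
  have G: "gradient (mollify (r j) U) x = mollify (r j) g x" if "x \<in> cball z R" for j x
    using gradient_mollify[OF r(1)] sub[OF that] e(2) by blast
  obtain D where D: "\<And>x. x \<in> cball z (R + e) \<Longrightarrow> norm (U x) \<le> D"
    using continuous_bounded_on_cball[OF U(1)] by metis
  have UD: "mollify (r j) U x \<le> D" if "x \<in> cball z R" for j x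
    using norm_mollify_diff_le[of U "r j" x 0 D] r D sub[OF that] by fastforce
  show ?thesis
  proof (rule that[of "\<lambda>j. mollify (r (s j)) U" D])
    show "mollify (r (s j)) U x \<ge> 0" for j x
      unfolding mollify_def by (auto intro!: Bochner_Integration.integral_nonneg mult_nonneg_nonneg moll_nonneg U)
    show "(\<lambda>j. mollify (r (s j)) U x) \<longlonglongrightarrow> U x" for x
      by (rule mollify_tendsto[OF U(1) r(1) LIMSEQ_subseq_LIMSEQ[OF r0 s(1), unfolded o_def]])
    show "AE x in lborel. x \<in> cball z R \<longrightarrow> (\<lambda>j. gradient (mollify (r (s j)) U) x) \<longlonglongrightarrow> g x"
      using s(2)
    proof eventually_elim
      case (elim x)
      show ?case
      proof
        assume x: "x \<in> cball z R"
        then have "(\<lambda>j. mollify (r (s j)) g x - g x) \<longlonglongrightarrow> 0" using elim by simp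
        then show "(\<lambda>j. gradient (mollify (r (s j)) U) x) \<longlonglongrightarrow> g x"
          using x by (simp add: G LIM_zero_iff)
      qed
    qed
  qed (auto simp: smooth_on_mollify r U G mM UD)
qed

section \<open>Testing the equation: energy identity and estimate\<close>

abbreviation (input) A :: "'a \<Rightarrow> 'a" where "A x \<equiv> norm (g x) powr (p - 2) *\<^sub>R g x"

lemma A_inner_g: "A x \<bullet> g x = norm (g x) powr p"
proof (cases "g x = 0")
  case False
  have "A x \<bullet> g x = norm (g x) powr (p - 2) * norm (g x) powr 2"
    using False by (simp add: power2_norm_eq_inner[symmetric])
  also have "\<dots> = norm (g x) powr (p - 2 + 2)" by (rule powr_add[symmetric])
  finally show ?thesis by simp
qed simp

lemma norm_A: "norm (A x) = norm (g x) powr (p - 1)"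
proof (cases "g x = 0")
  case False
  have "norm (A x) = norm (g x) powr (p - 2) * norm (g x) powr 1" using False by simp
  also have "\<dots> = norm (g x) powr (p - 2 + 1)" by (rule powr_add[symmetric])
  finally show ?thesis by simp
qed simp

lemma norm_A_le: "norm (A x) \<le> M powr (p - 1)"
  unfolding norm_A using gM[of x] p by (intro powr_mono2) auto

lemma gradient_mult_powr:
  assumes \<eta>: "smooth_on UNIV \<eta>" and w: "smooth_on UNIV w" "\<And>x. w x \<ge> 0" and "\<epsilon> > 0"
  shows "smooth_on UNIV (\<lambda>x. \<eta> x * (w x + \<epsilon>) powr (1 - p))"
    and "gradient (\<lambda>x. \<eta> x * (w x + \<epsilon>) powr (1 - p)) x =
      (w x + \<epsilon>) powr (1 - p) *\<^sub>R gradient \<eta> x - ((p - 1) * \<eta> x * (w x + \<epsilon>) powr (- p)) *\<^sub>R gradient w x"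
proof -
  have pos: "w x + \<epsilon> > 0" for x using w(2)[of x] \<open>\<epsilon> > 0\<close> by simp
  have "smooth_on UNIV (\<lambda>x. w x + \<epsilon>)"
    using w(1) unfolding smooth_on_def by (auto intro: Ck_on_add Ck_on_const)
  then show s: "smooth_on UNIV (\<lambda>x. \<eta> x * (w x + \<epsilon>) powr (1 - p))"
    by (intro smooth_on_mult \<eta> smooth_on_powr pos)
  have "((\<lambda>t. t powr (1 - p)) has_real_derivative (1 - p) * (w x + \<epsilon>) powr (- p)) (at (w x + \<epsilon>))"
    using pos[of x] by (auto intro!: derivative_eq_intros)
  then have d1: "((\<lambda>t. t powr (1 - p)) has_derivative (\<lambda>t. ((1 - p) * (w x + \<epsilon>) powr (- p)) * t)) (at (w x + \<epsilon>))"
    by (simp add: has_field_derivative_def)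
  have "((\<lambda>x. w x + \<epsilon>) has_derivative (\<lambda>v. gradient w x \<bullet> v)) (at x)"
    using has_derivative_add[OF has_derivative_gradient[OF w(1)] has_derivative_const] by simp
  from has_derivative_mult[OF has_derivative_gradient[OF \<eta>] has_derivative_compose[OF this d1]]
  show "gradient (\<lambda>x. \<eta> x * (w x + \<epsilon>) powr (1 - p)) x =
      (w x + \<epsilon>) powr (1 - p) *\<^sub>R gradient \<eta> x - ((p - 1) * \<eta> x * (w x + \<epsilon>) powr (- p)) *\<^sub>R gradient w x"
    by (intro gradient_eqI[OF s]) (simp add: inner_diff_left algebra_simps)
qed

text \<open>The weak equation holds for the smooth \<eta> (w j + \<epsilon>)^(1-p). Since
  \<open>w j\<close> is nonnegative, the negative powers are bounded by powers of \<epsilon>, so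
  dominated convergence replaces \<open>w j\<close> by \<open>U\<close> and its gradient by
  \<open>g\<close>.\<close>

lemma energy_identity:
  assumes e: "e > 0" "cball z (R + e) \<subseteq> \<Omega>" and \<eta>: "smooth_on UNIV \<eta>" "\<And>x. x \<notin> cball z R \<Longrightarrow> \<eta> x = 0"
    and \<epsilon>: "\<epsilon> > 0"
  shows "(\<integral>x. A x \<bullet> ((U x + \<epsilon>) powr (1 - p) *\<^sub>R gradient \<eta> x - ((p - 1) * \<eta> x * (U x + \<epsilon>) powr (- p)) *\<^sub>R g x) \<partial>lborel)
    = (\<integral>x. F x * (\<eta> x * (U x + \<epsilon>) powr (1 - p)) \<partial>lborel)"
proof -
  obtain w D0 where w: "\<And>j. smooth_on UNIV (w j)" "\<And>j x. w j x \<ge> 0" "\<And>x. (\<lambda>j. w j x) \<longlonglongrightarrow> U x"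
    "\<And>j x. x \<in> cball z R \<Longrightarrow> norm (gradient (w j) x) \<le> M"
    "AE x in lborel. x \<in> cball z R \<longrightarrow> (\<lambda>j. gradient (w j) x) \<longlonglongrightarrow> g x"
    "\<And>j x. x \<in> cball z R \<Longrightarrow> w j x \<le> D0"
    using smooth_approximation[OF e] by blast
  define \<psi> where "\<psi> j x = \<eta> x * (w j x + \<epsilon>) powr (1 - p)" for j x
  note \<psi>s = gradient_mult_powr(1)[OF \<eta>(1) w(1,2) \<epsilon>, folded \<psi>_def]
  have \<psi>g: "gradient (\<psi> j) x = (w j x + \<epsilon>) powr (1 - p) *\<^sub>R gradient \<eta> x
      - ((p - 1) * \<eta> x * (w j x + \<epsilon>) powr (- p)) *\<^sub>R gradient (w j) x" for j x
    unfolding \<psi>_def[abs_def] by (rule gradient_mult_powr(2)[OF \<eta>(1) w(1,2) \<epsilon>])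
  have g0: "gradient \<eta> x = 0" if "x \<notin> cball z R" for x by (rule gradient_eq_0_outside[OF \<eta>(1) closed_cball \<eta>(2) that])
  have KO: "cball z R \<subseteq> \<Omega>" using e by auto
  have test: "\<psi> j \<in> test_functions \<Omega>" for j
    using \<psi>s \<eta>(2) KO by (intro test_functionsI) (auto simp: \<psi>_def[abs_def])
  have [measurable]: "\<eta> \<in> borel_measurable borel" "w j \<in> borel_measurable borel"
      "gradient \<eta> \<in> borel_measurable borel" "gradient (w j) \<in> borel_measurable borel" for j
    by (auto intro!: borel_measurable_continuous_onI smooth_on_continuous continuous_on_gradient \<eta> w)
  obtain B where B: "B \<ge> 0" "\<And>x. x \<in> cball z R \<Longrightarrow> norm (gradient \<eta> x) \<le> B"
    using continuous_bounded_on_cball[OF continuous_on_gradient[OF \<eta>(1)]] by metis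
  obtain E where E: "E \<ge> 0" "\<And>x. x \<in> cball z R \<Longrightarrow> norm (\<eta> x) \<le> E"
    using continuous_bounded_on_cball[OF smooth_on_continuous[OF \<eta>(1)]] by metis
  obtain D where D: "D \<ge> 0" "\<And>x. x \<in> cball z R \<Longrightarrow> norm (F x) \<le> D"
    using continuous_bounded_on_cball[OF F] by metis
  have pos: "w j x + \<epsilon> > 0" "U x + \<epsilon> > 0" for j x using w(2)[of j x] U(2)[of x] \<epsilon> by auto
  have b1: "(w j x + \<epsilon>) powr (1 - p) \<le> \<epsilon> powr (1 - p)" "(w j x + \<epsilon>) powr (- p) \<le> \<epsilon> powr (- p)" for j x
    using w(2) \<epsilon> p by (auto intro!: powr_shift_le)
  have lp: "(\<lambda>j. (w j x + \<epsilon>) powr s) \<longlonglongrightarrow> (U x + \<epsilon>) powr s" for s x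
    using pos(2)[of x] by (intro tendsto_intros w(3)) auto
  have "(\<lambda>j. \<integral>x. A x \<bullet> gradient (\<psi> j) x \<partial>lborel) \<longlonglongrightarrow>
    (\<integral>x. A x \<bullet> ((U x + \<epsilon>) powr (1 - p) *\<^sub>R gradient \<eta> x - ((p - 1) * \<eta> x * (U x + \<epsilon>) powr (- p)) *\<^sub>R g x) \<partial>lborel)"
    unfolding \<psi>g
  proof (rule integral_cball_tendsto[where z=z and s=R and
        C="M powr (p - 1) * (\<epsilon> powr (1 - p) * B + (p - 1) * E * \<epsilon> powr (- p) * M)"])
    fix j x assume x: "x \<in> cball z R"
    let ?v = "(w j x + \<epsilon>) powr (1 - p) *\<^sub>R gradient \<eta> x - ((p - 1) * \<eta> x * (w j x + \<epsilon>) powr (- p)) *\<^sub>R gradient (w j) x"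
    have "norm ?v \<le> (w j x + \<epsilon>) powr (1 - p) * norm (gradient \<eta> x) + (p - 1) * norm (\<eta> x) * (w j x + \<epsilon>) powr (- p) * norm (gradient (w j) x)"
      using p by (intro order_trans[OF norm_triangle_ineq4]) (simp add: abs_mult)
    also have "\<dots> \<le> \<epsilon> powr (1 - p) * B + (p - 1) * E * \<epsilon> powr (- p) * M"
      using x p E(1) by (intro add_mono mult_mono b1 B E w(4)) auto
    finally show "norm (A x \<bullet> ?v) \<le> M powr (p - 1) * (\<epsilon> powr (1 - p) * B + (p - 1) * E * \<epsilon> powr (- p) * M)"
      unfolding real_norm_def by (rule abs_inner_le[OF norm_A_le])
  next
    show "AE x in lborel. x \<in> cball z R \<longrightarrow> (\<lambda>j. A x \<bullet> ((w j x + \<epsilon>) powr (1 - p) *\<^sub>R gradient \<eta> x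
        - ((p - 1) * \<eta> x * (w j x + \<epsilon>) powr (- p)) *\<^sub>R gradient (w j) x)) \<longlonglongrightarrow>
      A x \<bullet> ((U x + \<epsilon>) powr (1 - p) *\<^sub>R gradient \<eta> x - ((p - 1) * \<eta> x * (U x + \<epsilon>) powr (- p)) *\<^sub>R g x)"
      using w(5) by eventually_elim (auto intro!: tendsto_intros lp)
  qed (auto simp: g0 \<eta>(2))
  moreover have "(\<lambda>j. \<integral>x. F x * \<psi> j x \<partial>lborel) \<longlonglongrightarrow> (\<integral>x. F x * (\<eta> x * (U x + \<epsilon>) powr (1 - p)) \<partial>lborel)"
    unfolding \<psi>_def
  proof (rule integral_cball_tendsto[where z=z and s=R and C="D * (E * \<epsilon> powr (1 - p))"])
    fix j x assume x: "x \<in> cball z R"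
    show "norm (F x * (\<eta> x * (w j x + \<epsilon>) powr (1 - p))) \<le> D * (E * \<epsilon> powr (1 - p))"
      unfolding norm_mult using x D(1) E(1) b1(1)[of j x] by (intro mult_mono D E) auto
  next
    show "AE x in lborel. x \<in> cball z R \<longrightarrow> (\<lambda>j. F x * (\<eta> x * (w j x + \<epsilon>) powr (1 - p))) \<longlonglongrightarrow>
        F x * (\<eta> x * (U x + \<epsilon>) powr (1 - p))"
      by (auto intro!: tendsto_intros lp AE_I2)
  qed (auto simp: \<eta>(2))
  ultimately show ?thesis
    unfolding weak_eq[OF test] by (rule LIMSEQ_unique)
qed

text \<open>Integrates a pointwise inequality against the identity for \<eta> = bump^k. The power k
  pays for the derivative of the cut-off: the gradient of \<eta> still carries bump^(k-1), which
  \<eta>^(1 - 1/p) dominates precisely because k is at least p.\<close>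

lemma energy_estimate:
  fixes k :: nat
  assumes e: "e > 0" "cball z (R + e) \<subseteq> \<Omega>" and R: "R > 0" and k: "real k \<ge> p" and \<epsilon>: "\<epsilon> > 0"
  shows "(\<integral>x. norm (g x) powr p * (U x + \<epsilon>) powr (- p) * bump z R x ^ k \<partial>lborel) / 2
      + (\<integral>x. F x * (bump z R x ^ k * (U x + \<epsilon>) powr (1 - p)) \<partial>lborel)
    \<le> (8 * real k / R) powr p * measure lborel (cball z R)"
proof -
  define \<phi> where "\<phi> = bump z R"
  define \<eta> where "\<eta> x = \<phi> x ^ k" for x
  define B where "B = 4 * real k / R"
  have k2: "k \<ge> 2" using k p by linarith
  have B0: "B > 0" using k2 R by (simp add: B_def)
  have \<phi>s: "smooth_on UNIV \<phi>" by (simp add: \<phi>_def smooth_on_bump)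
  have \<phi>b: "0 \<le> \<phi> x" "\<phi> x \<le> 1" for x by (simp_all add: \<phi>_def bump_bounds)
  have \<eta>s: "smooth_on UNIV \<eta>" unfolding \<eta>_def[abs_def] by (intro smooth_on_power \<phi>s)
  have \<eta>0: "\<eta> x = 0" if "x \<notin> cball z R" for x
    using that R k2 by (auto simp: \<eta>_def \<phi>_def bump_eq_0_iff)
  have \<eta>b: "0 \<le> \<eta> x" "\<eta> x \<le> 1" for x using \<phi>b by (auto simp: \<eta>_def power_le_one)
  have \<eta>g: "gradient \<eta> x = (real k * \<phi> x ^ (k - 1)) *\<^sub>R gradient \<phi> x" for x
  proof (rule gradient_eqI[OF \<eta>s])
    from has_derivative_power[OF has_derivative_gradient[OF \<phi>s, of x], of k]
    show "(\<eta> has_derivative (\<lambda>v. ((real k * \<phi> x ^ (k - 1)) *\<^sub>R gradient \<phi> x) \<bullet> v)) (at x)"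
      by (simp add: \<eta>_def[abs_def] algebra_simps)
  qed
  have pos: "U x + \<epsilon> > 0" for x using U(2)[of x] \<epsilon> by auto
  have [measurable]: "\<eta> \<in> borel_measurable borel" "gradient \<eta> \<in> borel_measurable borel"
    by (auto intro!: borel_measurable_continuous_onI smooth_on_continuous continuous_on_gradient \<eta>s)
  define X where "X x = norm (g x) powr p * (U x + \<epsilon>) powr (- p) * \<eta> x" for x
  define Y where "Y x = A x \<bullet> ((U x + \<epsilon>) powr (1 - p) *\<^sub>R gradient \<eta> x - ((p - 1) * \<eta> x * (U x + \<epsilon>) powr (- p)) *\<^sub>R g x)" for x
  have X0: "X x \<ge> 0" for x by (simp add: X_def \<eta>b)
  have g0: "gradient \<eta> x = 0" if "x \<notin> cball z R" for x by (rule gradient_eq_0_outside[OF \<eta>s closed_cball \<eta>0 that])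
  \<comment> \<open>Here Y is the mixed term minus (p - 1) X. Absorption bounds the mixed term by
    X/2 + (2B)^p, and p \<ge> 2 makes the subtracted part at least X, so X/2 is left over for the
    estimate.\<close>
  have pw: "Y x + X x / 2 \<le> indicator (cball z R) x * (2 * B) powr p" for x
  proof (cases "x \<in> cball z R")
    case True
    have "A x \<bullet> gradient \<eta> x * (U x + \<epsilon>) powr (1 - p) \<le> norm (g x) powr (p - 1) * (B * \<phi> x ^ (k - 1)) * (U x + \<epsilon>) powr (1 - p)"
    proof (intro mult_right_mono)
      have "norm (gradient \<phi> x) \<le> 4 / R" unfolding \<phi>_def using norm_gradient_bump_le[OF R True] .
      then have "norm (gradient \<eta> x) \<le> real k * \<phi> x ^ (k - 1) * (4 / R)"
        unfolding \<eta>g norm_scaleR using \<phi>b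
        by (auto simp: abs_mult simp del: times_divide_eq_right intro!: mult_left_mono)
      also have "\<dots> = B * \<phi> x ^ (k - 1)" by (simp add: B_def)
      finally have "norm (A x) * norm (gradient \<eta> x) \<le> norm (g x) powr (p - 1) * (B * \<phi> x ^ (k - 1))"
        unfolding norm_A by (intro mult_left_mono) auto
      then show "A x \<bullet> gradient \<eta> x \<le> norm (g x) powr (p - 1) * (B * \<phi> x ^ (k - 1))"
        using norm_cauchy_schwarz[of "A x" "gradient \<eta> x"] by linarith
    qed simp
    also have "\<dots> = B * (norm (g x) powr (p - 1) * (U x + \<epsilon>) powr (1 - p) * \<phi> x ^ (k - 1))" by (simp add: mult_ac)
    also have "\<dots> \<le> B * X x powr (1 - 1/p)"
    proof (intro mult_left_mono)
      \<comment> \<open>For values in [0, 1] the smaller exponent gives the larger power, and k -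
        k/p \<le> k - 1 is the condition k \<ge> p.\<close>
      have "\<phi> x ^ (k - 1) \<le> (\<phi> x ^ k) powr (1 - 1/p)"
      proof (cases "\<phi> x = 0")
        case False
        then have f: "\<phi> x > 0" using \<phi>b[of x] by simp
        have "\<phi> x ^ (k - 1) = \<phi> x powr (real k - 1)"
          using f k2 by (subst powr_realpow[symmetric]) (auto simp: of_nat_diff)
        also have "\<dots> \<le> \<phi> x powr (real k * (1 - 1/p))"
          using f \<phi>b(2)[of x] k p by (intro powr_mono') (auto simp: field_simps)
        also have "\<dots> = (\<phi> x ^ k) powr (1 - 1/p)"
          using f by (simp add: powr_powr flip: powr_realpow)
        finally show ?thesis .
      qed (use k2 in \<open>auto simp: power_0_left\<close>)
      then have "norm (g x) powr (p - 1) * (U x + \<epsilon>) powr (1 - p) * \<phi> x ^ (k - 1) \<le>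
         norm (g x) powr (p - 1) * (U x + \<epsilon>) powr (1 - p) * (\<phi> x ^ k) powr (1 - 1/p)"
        by (intro mult_left_mono) auto
      also have "\<dots> = X x powr (1 - 1/p)"
        using p pos[of x] \<phi>b[of x] by (simp add: X_def \<eta>_def powr_mult powr_powr right_diff_distrib)
      finally show "norm (g x) powr (p - 1) * (U x + \<epsilon>) powr (1 - p) * \<phi> x ^ (k - 1) \<le> X x powr (1 - 1/p)" .
    qed (use B0 in simp)
    also have "\<dots> \<le> X x / 2 + (2 * B) powr p" using B0 X0 p by (intro mult_powr_absorb) auto
    finally have "A x \<bullet> gradient \<eta> x * (U x + \<epsilon>) powr (1 - p) \<le> X x / 2 + (2 * B) powr p" .
    moreover have "Y x = A x \<bullet> gradient \<eta> x * (U x + \<epsilon>) powr (1 - p) - (p - 1) * X x"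
      unfolding Y_def X_def inner_diff_right inner_scaleR_right A_inner_g by (simp add: mult_ac)
    moreover have "1 * X x \<le> (p - 1) * X x" using X0 p by (intro mult_right_mono) auto
    ultimately show ?thesis using True by simp
  next
    case False
    then show ?thesis by (simp add: Y_def X_def \<eta>0 g0)
  qed
  obtain C where C: "C \<ge> 0" "\<And>x. x \<in> cball z R \<Longrightarrow> norm (gradient \<eta> x) \<le> C"
    using continuous_bounded_on_cball[OF continuous_on_gradient[OF \<eta>s]] by metis
  have b1: "(U x + \<epsilon>) powr (1 - p) \<le> \<epsilon> powr (1 - p)" "(U x + \<epsilon>) powr (- p) \<le> \<epsilon> powr (- p)" for x
    using U(2) \<epsilon> p by (auto intro!: powr_shift_le)
  have iX: "integrable lborel X"
  proof (rule integrable_cball_support[where z=z and s=R and C="M powr p * \<epsilon> powr (- p) * 1"])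
    show "norm (X x) \<le> M powr p * \<epsilon> powr (- p) * 1" for x
      unfolding X_def norm_mult using gM[of x] b1[of x] \<eta>b[of x] p
      by (intro mult_mono) (auto intro!: powr_mono2)
    show "X \<in> borel_measurable borel" unfolding X_def[abs_def] by measurable
  qed (auto simp: X_def \<eta>0)
  have iY: "integrable lborel Y"
  proof (rule integrable_cball_support[where z=z and s=R and
        C="M powr (p - 1) * (\<epsilon> powr (1 - p) * C + (p - 1) * 1 * \<epsilon> powr (- p) * M)"])
    show "Y \<in> borel_measurable borel" unfolding Y_def[abs_def] by measurable
    fix x assume x: "x \<in> cball z R"
    let ?v = "(U x + \<epsilon>) powr (1 - p) *\<^sub>R gradient \<eta> x - ((p - 1) * \<eta> x * (U x + \<epsilon>) powr (- p)) *\<^sub>R g x"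
    have "norm ?v \<le> (U x + \<epsilon>) powr (1 - p) * norm (gradient \<eta> x) + (p - 1) * norm (\<eta> x) * (U x + \<epsilon>) powr (- p) * norm (g x)"
      using p by (intro order_trans[OF norm_triangle_ineq4]) (simp add: abs_mult)
    also have "\<dots> \<le> \<epsilon> powr (1 - p) * C + (p - 1) * 1 * \<epsilon> powr (- p) * M"
      using x p \<eta>b[of x] by (intro add_mono mult_mono b1 C gM) auto
    finally show "norm (Y x) \<le> M powr (p - 1) * (\<epsilon> powr (1 - p) * C + (p - 1) * 1 * \<epsilon> powr (- p) * M)"
      unfolding Y_def real_norm_def by (rule abs_inner_le[OF norm_A_le])
  qed (auto simp: Y_def \<eta>0 g0)
  have "integral\<^sup>L lborel Y + integral\<^sup>L lborel X / 2 = (\<integral>x. Y x + X x / 2 \<partial>lborel)"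
    using iX iY by simp
  also have "\<dots> \<le> (\<integral>x. indicator (cball z R) x * (2 * B) powr p \<partial>lborel)"
    using iX iY pw integrable_cball_bounded[of "\<lambda>_. (2 * B) powr p" z R "(2 * B) powr p"]
    by (intro integral_mono) auto
  also have "\<dots> = (2 * B) powr p * measure lborel (cball z R)" by simp
  finally have "integral\<^sup>L lborel X / 2 + integral\<^sup>L lborel Y \<le> (2 * B) powr p * measure lborel (cball z R)" by simp
  moreover have "integral\<^sup>L lborel Y = (\<integral>x. F x * (\<eta> x * (U x + \<epsilon>) powr (1 - p)) \<partial>lborel)"
    unfolding Y_def by (rule energy_identity[OF e \<eta>s \<eta>0 \<epsilon>])
  ultimately show ?thesis by (simp add: X_def[abs_def] \<eta>_def \<phi>_def B_def)
qed

section \<open>Logarithmic estimates and positivity almost everywhere\<close>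

text \<open>The energy estimate is used on the slightly larger radius \<open>R'\<close>, because the
  bump is bounded away from 0, by the constant behind \<open>\<kappa>\<close>, only on a smaller
  ball. The inequality t \<le> 1 + t^p passes from the p-th power to the first. What matters is that
  \<open>C\<close> does not depend on \<epsilon>.\<close>

lemma log_gradient_bound:
  assumes e: "e > 0" "cball z (R + e) \<subseteq> \<Omega>" and R: "R > 0"
  obtains C where "\<And>\<epsilon>. \<epsilon> > 0 \<Longrightarrow> (\<integral>x. indicator (cball z R) x * (norm (g x) / (U x + \<epsilon>)) \<partial>lborel) \<le> C"
proof -
  obtain k :: nat where k: "real k \<ge> p" using real_arch_simple by blast
  define R' where "R' = R + e/2"
  define \<kappa> where "\<kappa> = flat 0 (1 - R\<^sup>2 / R'\<^sup>2) ^ k"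
  have R': "R < R'" "0 < R'" "cball z (R' + e/2) \<subseteq> \<Omega>" "e/2 > 0" using e R by (auto simp: R'_def)
  have "R\<^sup>2 < R'\<^sup>2" using R R' by (intro power_strict_mono) auto
  then have "1 - R\<^sup>2 / R'\<^sup>2 > 0" using R' by simp
  then have \<kappa>: "\<kappa> > 0" by (simp add: \<kappa>_def flat_0)
  let ?V = "(8 * real k / R') powr p * measure lborel (cball z R')"
  show ?thesis
  proof (rule that[of "measure lborel (cball z R) + 2 * ?V / \<kappa>"])
    fix \<epsilon> :: real assume \<epsilon>: "\<epsilon> > 0"
    have pos: "U x + \<epsilon> > 0" for x using U(2)[of x] \<epsilon> by auto
    define X where "X x = norm (g x) powr p * (U x + \<epsilon>) powr (- p) * bump z R' x ^ k" for x
    have k2: "k \<ge> 2" using k p by linarith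
    have iX: "integrable lborel X"
    proof (rule integrable_cball_support[where z=z and s=R' and C="M powr p * \<epsilon> powr (- p) * 1"])
      show "norm (X x) \<le> M powr p * \<epsilon> powr (- p) * 1" for x
        unfolding X_def norm_mult using gM[of x] U(2)[of x] \<epsilon> bump_bounds[of z R' x] p
        by (intro mult_mono) (auto intro!: powr_mono2 powr_shift_le simp: power_le_one)
      show "X \<in> borel_measurable borel" unfolding X_def[abs_def] by measurable
      show "X x = 0" if "x \<notin> cball z R'" for x
        using that R' k2 by (simp add: X_def bump_eq_0_iff)
    qed
    have X0: "X x \<ge> 0" for x by (simp add: X_def bump_bounds)
    have pw: "indicator (cball z R) x * (norm (g x) / (U x + \<epsilon>)) \<le> indicator (cball z R) x + X x / \<kappa>" for x
    proof (cases "x \<in> cball z R")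
      case True
      let ?t = "norm (g x) / (U x + \<epsilon>)"
      have t0: "?t \<ge> 0" using pos[of x] by simp
      have "?t \<le> 1 + ?t powr p"
      proof (cases "?t \<le> 1")
        case False
        then have "?t powr 1 \<le> ?t powr p" using p by (intro powr_mono) auto
        then have "?t \<le> ?t powr p" by (simp only: powr_one[OF t0])
        then show ?thesis by linarith
      qed (use powr_ge_zero[of ?t p] in linarith)
      moreover have "?t powr p * \<kappa> \<le> X x"
      proof -
        have "\<kappa> \<le> bump z R' x ^ k" unfolding \<kappa>_def
          using True R R' by (intro power_mono bump_ge) (auto simp: flat_bounds)
        moreover have "?t powr p = norm (g x) powr p * (U x + \<epsilon>) powr (- p)"
          using pos[of x] by (simp add: powr_divide powr_minus_divide)
        ultimately show ?thesis unfolding X_def by (simp add: mult_left_mono)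
      qed
      then have "?t powr p \<le> X x / \<kappa>" using \<kappa> by (simp add: pos_le_divide_eq)
      ultimately show ?thesis using True by simp
    next
      case False
      then show ?thesis using \<kappa> by (simp add: X_def bump_bounds)
    qed
    have iK: "integrable lborel (indicator (cball z R) :: 'a \<Rightarrow> real)"
      using integrable_cball_bounded[of "\<lambda>_. 1::real" z R 1] by simp
    have "(\<integral>x. indicator (cball z R) x * (norm (g x) / (U x + \<epsilon>)) \<partial>lborel) \<le> (\<integral>x. indicator (cball z R) x + X x / \<kappa> \<partial>lborel)"
      using iK iX pw pos \<kappa> by (intro integral_mono') (auto simp: X0 less_imp_le)
    also have "\<dots> = measure lborel (cball z R) + integral\<^sup>L lborel X / \<kappa>" using iK iX by simp
    also have "integral\<^sup>L lborel X / 2 \<le> ?V"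
    proof -
      have "(\<integral>x. F x * (bump z R' x ^ k * (U x + \<epsilon>) powr (1 - p)) \<partial>lborel) \<ge> 0"
        by (intro Bochner_Integration.integral_nonneg) (auto simp: F_nonneg bump_bounds)
      then show ?thesis using energy_estimate[OF R'(4,3,2) k \<epsilon>] unfolding X_def[abs_def] by linarith
    qed
    then have "measure lborel (cball z R) + integral\<^sup>L lborel X / \<kappa> \<le> measure lborel (cball z R) + 2 * ?V / \<kappa>"
      using \<kappa> by (intro add_left_mono divide_right_mono) auto
    finally show "(\<integral>x. indicator (cball z R) x * (norm (g x) / (U x + \<epsilon>)) \<partial>lborel) \<le> measure lborel (cball z R) + 2 * ?V / \<kappa>" .
  qed
qed

text \<open>The translation estimate needs a differentiable function, so it is applied to ln (w j +
  \<epsilon>) and carried to the limit. Positivity of \<epsilon> bounds both the logarithms and the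
  quotients uniformly in j.\<close>

lemma log_translation_bound:
  assumes e: "e > 0" "cball z (R + e) \<subseteq> \<Omega>" and \<epsilon>: "\<epsilon> > 0"
    and S [measurable]: "S \<in> sets borel" and SK: "S \<subseteq> cball z R" "\<And>x. x \<in> S \<Longrightarrow> x + h \<in> cball z R"
  shows "(\<integral>x. indicator S x * (ln (U (x + h) + \<epsilon>) - ln (U x + \<epsilon>)) \<partial>lborel)
     \<le> norm h * (\<integral>x. indicator (cball z R) x * (norm (g x) / (U x + \<epsilon>)) \<partial>lborel)"
proof -
  let ?K = "cball z R"
  obtain w D where w: "\<And>j. smooth_on UNIV (w j)" "\<And>j x. w j x \<ge> 0" "\<And>x. (\<lambda>j. w j x) \<longlonglongrightarrow> U x"
    "\<And>j x. x \<in> ?K \<Longrightarrow> norm (gradient (w j) x) \<le> M"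
    "AE x in lborel. x \<in> ?K \<longrightarrow> (\<lambda>j. gradient (w j) x) \<longlonglongrightarrow> g x"
    "\<And>j x. x \<in> ?K \<Longrightarrow> w j x \<le> D"
    using smooth_approximation[OF e] by blast
  have pos: "w j x + \<epsilon> > 0" "U x + \<epsilon> > 0" for j x using w(2)[of j x] U(2)[of x] \<epsilon> by auto
  define G where "G j x = (1 / (w j x + \<epsilon>)) *\<^sub>R gradient (w j) x" for j x
  have [measurable]: "w j \<in> borel_measurable borel" "gradient (w j) \<in> borel_measurable borel" for j
    by (auto intro!: borel_measurable_continuous_onI smooth_on_continuous continuous_on_gradient w)
  have ineq: "(\<integral>x. indicator S x * (ln (w j (x + h) + \<epsilon>) - ln (w j x + \<epsilon>)) \<partial>lborel)
      \<le> norm h * (\<integral>x. indicator ?K x * norm (G j x) \<partial>lborel)" for j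
  proof (rule integral_translate_diff_le[OF _ _ S SK])
    fix x
    have "((\<lambda>x. w j x + \<epsilon>) has_derivative (\<lambda>v. gradient (w j) x \<bullet> v)) (at x)"
      using has_derivative_add[OF has_derivative_gradient[OF w(1)] has_derivative_const] by simp
    from has_derivative_ln[OF pos(1) this]
    show "((\<lambda>x. ln (w j x + \<epsilon>)) has_derivative (\<lambda>v. G j x \<bullet> v)) (at x)"
      by (simp add: G_def divide_inverse mult.commute)
    show "continuous_on UNIV (G j)" unfolding G_def[abs_def]
      using pos(1)[of j] by (intro continuous_intros smooth_on_continuous continuous_on_gradient w) (auto simp: less_imp_neq[symmetric])
  qed
  have ln_b: "\<bar>ln (w j x + \<epsilon>)\<bar> \<le> \<bar>ln \<epsilon>\<bar> + \<bar>ln (D + \<epsilon>)\<bar>" if "x \<in> ?K" for j x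
  proof -
    have "ln \<epsilon> \<le> ln (w j x + \<epsilon>)" "ln (w j x + \<epsilon>) \<le> ln (D + \<epsilon>)"
      using w(2)[of j x] w(6)[OF that, of j] \<epsilon> by (auto intro!: ln_mono)
    then show ?thesis by linarith
  qed
  have L1: "(\<lambda>j. \<integral>x. indicator S x * (ln (w j (x + h) + \<epsilon>) - ln (w j x + \<epsilon>)) \<partial>lborel) \<longlonglongrightarrow>
      (\<integral>x. indicator S x * (ln (U (x + h) + \<epsilon>) - ln (U x + \<epsilon>)) \<partial>lborel)"
  proof (rule integral_cball_tendsto[where z=z and s=R and C="2 * (\<bar>ln \<epsilon>\<bar> + \<bar>ln (D + \<epsilon>)\<bar>)"])
    fix j x assume "x \<in> ?K"
    show "norm (indicator S x * (ln (w j (x + h) + \<epsilon>) - ln (w j x + \<epsilon>))) \<le> 2 * (\<bar>ln \<epsilon>\<bar> + \<bar>ln (D + \<epsilon>)\<bar>)"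
    proof (cases "x \<in> S")
      case True
      then show ?thesis using ln_b[OF \<open>x \<in> ?K\<close>, of j] ln_b[OF SK(2)[OF True], of j] by simp
    qed simp
  next
    show "AE x in lborel. x \<in> ?K \<longrightarrow> (\<lambda>j. indicator S x * (ln (w j (x + h) + \<epsilon>) - ln (w j x + \<epsilon>)))
      \<longlonglongrightarrow> indicator S x * (ln (U (x + h) + \<epsilon>) - ln (U x + \<epsilon>))"
      using pos(2) by (auto intro!: AE_I2 tendsto_intros w(3) simp: less_imp_neq[symmetric])
  qed (use SK(1) in \<open>auto simp: indicator_def\<close>)
  have L2: "(\<lambda>j. \<integral>x. indicator ?K x * norm (G j x) \<partial>lborel) \<longlonglongrightarrow>
      (\<integral>x. indicator ?K x * (norm (g x) / (U x + \<epsilon>)) \<partial>lborel)"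
  proof (rule integral_cball_tendsto[where z=z and s=R and C="(1/\<epsilon>) * M"])
    fix j x assume x: "x \<in> ?K"
    have "norm (G j x) = (1 / (w j x + \<epsilon>)) * norm (gradient (w j) x)"
      using pos(1)[of j x] by (simp add: G_def)
    also have "\<dots> \<le> (1/\<epsilon>) * M"
      using w(2)[of j x] \<epsilon> by (intro mult_mono w(4)[OF x] divide_left_mono) auto
    finally show "norm (indicator ?K x * norm (G j x)) \<le> (1/\<epsilon>) * M" using x by simp
  next
    show "AE x in lborel. x \<in> ?K \<longrightarrow> (\<lambda>j. indicator ?K x * norm (G j x)) \<longlonglongrightarrow> indicator ?K x * (norm (g x) / (U x + \<epsilon>))"
      using w(5)
    proof eventually_elim
      case (elim x)
      show ?case
      proof
        assume x: "x \<in> ?K"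
        have "(\<lambda>j. norm (G j x)) \<longlonglongrightarrow> norm ((1 / (U x + \<epsilon>)) *\<^sub>R g x)"
          unfolding G_def using pos(2)[of x] elim x by (intro tendsto_intros w(3)) auto
        then show "(\<lambda>j. indicator ?K x * norm (G j x)) \<longlonglongrightarrow> indicator ?K x * (norm (g x) / (U x + \<epsilon>))"
          using x pos(2)[of x] by simp
      qed
    qed
    have "G j \<in> borel_measurable borel" for j unfolding G_def[abs_def] by measurable
    then show "(\<lambda>x. indicator ?K x * norm (G j x)) \<in> borel_measurable borel" for j
      by (intro borel_measurable_times borel_measurable_indicator borel_measurable_norm) auto
  qed (auto simp: indicator_def)
  show ?thesis
    by (rule LIMSEQ_le[OF L1 tendsto_mult[OF tendsto_const L2]]) (use ineq in blast)
qed

text \<open>\<open>S h\<close> is the part of the zero set that the shift by h carries into a ball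
  where U > m. There the increment of ln (U + \<epsilon>) is at least ln m - ln \<epsilon>, yet its
  integral is at most |h| times a constant free of \<epsilon>; so every \<open>S h\<close> is
  null.\<close>

lemma strong_maximum_principle:
  assumes e: "e > 0" "cball z (R + e) \<subseteq> \<Omega>" and R: "R > 0" and x1: "x1 \<in> ball z R" "U x1 > 0"
  shows "AE x in lborel. x \<in> ball z R \<longrightarrow> U x > 0"
proof -
  define Z where "Z = ball z R \<inter> U -` {0}"
  have "closed (U -` {0})" using U(1) by (simp add: continuous_closed_vimage continuous_on_eq_continuous_at)
  then have Z [measurable]: "Z \<in> sets borel" unfolding Z_def by (intro sets.Int) auto
  define m where "m = U x1 / 2"
  have m: "m > 0" using x1 by (simp add: m_def)
  have "open (ball z R \<inter> U -` {m<..})"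
    using U(1) by (intro open_Int open_vimage) auto
  moreover have "x1 \<in> ball z R \<inter> U -` {m<..}" using x1 by (simp add: m_def)
  ultimately obtain \<rho> where \<rho>: "\<rho> > 0" "ball x1 \<rho> \<subseteq> ball z R \<inter> U -` {m<..}"
    by (rule openE)
  define S where "S h = Z \<inter> {x. x + h \<in> ball x1 \<rho>}" for h
  have S [measurable]: "S h \<in> sets borel" for h
  proof -
    have "{x. x + h \<in> ball x1 \<rho>} = ball (x1 - h) \<rho>" by (auto simp: dist_norm algebra_simps)
    then show ?thesis unfolding S_def by auto
  qed
  have null: "emeasure lborel (S h) = 0" for h
  proof (rule ccontr)
    assume nz: "emeasure lborel (S h) \<noteq> 0"
    have SK: "S h \<subseteq> cball z R" "x + h \<in> cball z R" if "x \<in> S h" for x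
      using that \<rho>(2) by (force simp: S_def Z_def)+
    have sub: "S h \<subseteq> cball z R" unfolding S_def Z_def by auto
    have fin: "emeasure lborel (S h) < top"
      using emeasure_mono[OF sub, of lborel] emeasure_cball_less_top[of z R] by auto
    then have pos: "measure lborel (S h) > 0" using nz by (simp add: measure_def enn2real_positive_iff zero_less_iff_neq_zero)
    obtain C where C: "\<And>\<epsilon>. \<epsilon> > 0 \<Longrightarrow> (\<integral>x. indicator (cball z R) x * (norm (g x) / (U x + \<epsilon>)) \<partial>lborel) \<le> C"
      using log_gradient_bound[OF e R] by blast
    \<comment> \<open>Chosen so that q |S h| exceeds |h| C by exactly |S h|; then \<epsilon> is
      solved from ln m - ln \<epsilon> = q.\<close>
    define q where "q = norm h * C / measure lborel (S h) + 1"
    define \<epsilon> where "\<epsilon> = m / exp q"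
    have \<epsilon>: "\<epsilon> > 0" using m by (simp add: \<epsilon>_def)
    have "q * measure lborel (S h) = (\<integral>x. indicator (S h) x * q \<partial>lborel)" by simp
    also have "\<dots> \<le> (\<integral>x. indicator (S h) x * (ln (U (x + h) + \<epsilon>) - ln (U x + \<epsilon>)) \<partial>lborel)"
    proof (rule integral_mono)
      show "integrable lborel (\<lambda>x. indicator (S h) x * q)"
        using fin by (intro integrable_mult_left integrable_real_indicator) auto
      obtain D where D: "D \<ge> 0" "\<And>x. x \<in> cball z R \<Longrightarrow> norm (U x) \<le> D"
        using continuous_bounded_on_cball[OF U(1)] by metis
      have lnb: "\<bar>ln (U x + \<epsilon>)\<bar> \<le> \<bar>ln \<epsilon>\<bar> + \<bar>ln (D + \<epsilon>)\<bar>" if "x \<in> cball z R" for x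
      proof -
        have "ln \<epsilon> \<le> ln (U x + \<epsilon>)" "ln (U x + \<epsilon>) \<le> ln (D + \<epsilon>)"
          using U(2)[of x] D(2)[OF that] \<epsilon> by (auto intro!: ln_mono)
        then show ?thesis by linarith
      qed
      show "integrable lborel (\<lambda>x. indicator (S h) x * (ln (U (x + h) + \<epsilon>) - ln (U x + \<epsilon>)))"
      proof (rule integrable_cball_support[where z=z and s=R and C="2 * (\<bar>ln \<epsilon>\<bar> + \<bar>ln (D + \<epsilon>)\<bar>)"])
        fix x assume x: "x \<in> cball z R"
        show "norm (indicator (S h) x * (ln (U (x + h) + \<epsilon>) - ln (U x + \<epsilon>))) \<le> 2 * (\<bar>ln \<epsilon>\<bar> + \<bar>ln (D + \<epsilon>)\<bar>)"
        proof (cases "x \<in> S h")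
          case True
          then show ?thesis using lnb[OF x] lnb[OF SK(2)[OF True]] by simp
        qed simp
      qed (use sub in \<open>auto simp: indicator_def\<close>)
      fix x
      show "indicator (S h) x * q \<le> indicator (S h) x * (ln (U (x + h) + \<epsilon>) - ln (U x + \<epsilon>))"
      proof (cases "x \<in> S h")
        case True
        then have "U x = 0" "U (x + h) > m" using \<rho>(2) by (auto simp: S_def Z_def)
        have "q = ln m - ln \<epsilon>" using m by (simp add: \<epsilon>_def ln_div)
        also have "\<dots> \<le> ln (U (x + h) + \<epsilon>) - ln (U x + \<epsilon>)"
          using \<open>U x = 0\<close> \<open>U (x + h) > m\<close> m \<epsilon> by (auto intro!: ln_mono)
        finally show ?thesis using True by simp
      qed simp
    qed
    also have "\<dots> \<le> norm h * (\<integral>x. indicator (cball z R) x * (norm (g x) / (U x + \<epsilon>)) \<partial>lborel)"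
      by (rule log_translation_bound[OF e \<epsilon> S sub SK(2)])
    also have "\<dots> \<le> norm h * C" using C[OF \<epsilon>] by (intro mult_left_mono) auto
    finally have "q * measure lborel (S h) \<le> norm h * C" .
    moreover have "q * measure lborel (S h) = norm h * C + measure lborel (S h)"
      using pos by (simp add: q_def distrib_right)
    ultimately show False using pos by linarith
  qed
  \<comment> \<open>Any shift close to x1 - x moves x into the ball around \<open>x1\<close>, so
    shifts from a countable dense set already cover the zero set.\<close>
  obtain D :: "'a set" where D: "countable D" "\<And>X. open X \<Longrightarrow> X \<noteq> {} \<Longrightarrow> \<exists>d\<in>D. d \<in> X"
    using countable_dense_setE by metis
  have "Z \<subseteq> (\<Union>h\<in>D. S h)"
  proof
    fix x assume "x \<in> Z"
    obtain d where "d \<in> D" "d \<in> ball (x1 - x) \<rho>" using D(2)[of "ball (x1 - x) \<rho>"] \<rho>(1) by auto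
    then show "x \<in> (\<Union>h\<in>D. S h)" using \<open>x \<in> Z\<close> by (auto simp: S_def dist_norm algebra_simps)
  qed
  moreover have "(\<Union>h\<in>D. S h) \<in> null_sets lborel"
    using null D(1) S by (intro null_sets_UN') auto
  ultimately have "Z \<in> null_sets lborel" using null_sets_subset[of "\<Union>h\<in>D. S h" lborel Z] Z by auto
  then have "AE x in lborel. x \<notin> Z" by (rule AE_not_in)
  then show ?thesis
  proof eventually_elim
    case (elim x)
    then show ?case using U(2)[of x] by (auto simp: Z_def)
  qed
qed

text \<open>Keeps the reaction term of the energy estimate and discards the gradient term. Apart
  from the volumes, the left side is free of R while the right side decays like R^(-p).\<close>

lemma positive_solution_bound:
  fixes k :: nat
  assumes e: "e > 0" "cball z (R + e) \<subseteq> \<Omega>" and R: "R > 0" and k: "real k \<ge> p"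
    and pos: "AE x in lborel. x \<in> ball z R \<longrightarrow> U x > 0"
  shows "c * (flat 0 (3/4) ^ k * measure lborel (cball z (R/2))) \<le> (8 * real k / R) powr p * measure lborel (cball z R)"
proof -
  have k2: "k \<ge> 2" using k p by linarith
  define \<eta> where "\<eta> x = bump z R x ^ k" for x
  have \<eta>b: "0 \<le> \<eta> x" "\<eta> x \<le> 1" for x using bump_bounds[of z R x] by (auto simp: \<eta>_def power_le_one)
  have \<eta>0: "\<eta> x = 0" if "x \<notin> ball z R" for x using that R k2 by (simp add: \<eta>_def bump_eq_0_iff)
  have [measurable]: "\<eta> \<in> borel_measurable borel" unfolding \<eta>_def[abs_def] by measurable
  let ?V = "(8 * real k / R) powr p * measure lborel (cball z R)"
  \<comment> \<open>The lower bound for the reaction integrand with \<epsilon> = 1 / (n + 1): it is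
    dominated by c \<eta> and tends to it wherever U > 0.\<close>
  define f where "f n x = c * (\<eta> x * (U x / (U x + 1 / real (Suc n))) powr (p - 1))" for n :: nat and x
  have fb: "0 \<le> f n x" "f n x \<le> c * (\<eta> x * 1)" for n x
  proof -
    have "U x / (U x + 1 / real (Suc n)) \<le> 1" "0 \<le> U x / (U x + 1 / real (Suc n))"
      using U(2)[of x] by (auto simp: divide_le_eq_1 intro!: add_nonneg_pos)
    then have "(U x / (U x + 1 / real (Suc n))) powr (p - 1) \<le> 1 powr (p - 1)" using p by (intro powr_mono2) auto
    then show "f n x \<le> c * (\<eta> x * 1)" unfolding f_def using c \<eta>b[of x] by (intro mult_left_mono) auto
    show "0 \<le> f n x" unfolding f_def using c \<eta>b[of x] by auto
  qed
  have le: "integral\<^sup>L lborel (f n) \<le> ?V" for n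
  proof -
    define \<epsilon> where "\<epsilon> = 1 / real (Suc n)"
    have \<epsilon>: "\<epsilon> > 0" by (simp add: \<epsilon>_def)
    have Upos: "U x + \<epsilon> > 0" for x using U(2)[of x] \<epsilon> by simp
    obtain D where D: "D \<ge> 0" "\<And>x. x \<in> cball z R \<Longrightarrow> norm (F x) \<le> D"
      using continuous_bounded_on_cball[OF F] by metis
    have "integral\<^sup>L lborel (f n) \<le> (\<integral>x. F x * (bump z R x ^ k * (U x + \<epsilon>) powr (1 - p)) \<partial>lborel)"
    proof (rule integral_mono')
      show "integrable lborel (\<lambda>x. F x * (bump z R x ^ k * (U x + \<epsilon>) powr (1 - p)))"
      proof (rule integrable_cball_support[where z=z and s=R and C="D * (1 * \<epsilon> powr (1 - p))"])
        fix x assume x: "x \<in> cball z R"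
        show "norm (F x * (bump z R x ^ k * (U x + \<epsilon>) powr (1 - p))) \<le> D * (1 * \<epsilon> powr (1 - p))"
          unfolding norm_mult using D(1) \<eta>b[of x, unfolded \<eta>_def] powr_shift_le[OF U(2)[of x] \<epsilon>, of "1 - p"] p bump_bounds[of z R x]
          by (intro mult_mono D(2)[OF x]) auto
      next
        fix x assume "x \<notin> cball z R"
        then have "bump z R x = 0" using R by (simp add: bump_eq_0_iff)
        then show "F x * (bump z R x ^ k * (U x + \<epsilon>) powr (1 - p)) = 0" using k2 by simp
      qed measurable
      fix x
      have "f n x = c * (\<eta> x * (U x / (U x + \<epsilon>)) powr (p - 1))" by (simp add: f_def \<epsilon>_def)
      also have "\<dots> = (c * U x powr (p - 1)) * (\<eta> x * (U x + \<epsilon>) powr (1 - p))"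
        using U(2)[of x] Upos[of x] powr_minus_divide[of "U x + \<epsilon>" "p - 1"]
        by (simp add: powr_divide)
      also have "\<dots> \<le> F x * (\<eta> x * (U x + \<epsilon>) powr (1 - p))"
        using F_ge[of x] \<eta>b[of x] by (intro mult_right_mono) auto
      finally show "f n x \<le> F x * (bump z R x ^ k * (U x + \<epsilon>) powr (1 - p))" by (simp add: \<eta>_def)
      show "0 \<le> F x * (bump z R x ^ k * (U x + \<epsilon>) powr (1 - p))" by (simp add: F_nonneg bump_bounds)
    qed
    moreover have "0 \<le> (\<integral>x. norm (g x) powr p * (U x + \<epsilon>) powr (- p) * bump z R x ^ k \<partial>lborel)"
      by (intro Bochner_Integration.integral_nonneg) (auto simp: bump_bounds)
    ultimately show ?thesis using energy_estimate[OF e R k \<epsilon>] by linarith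
  qed
  have "(\<lambda>n. integral\<^sup>L lborel (f n)) \<longlonglongrightarrow> (\<integral>x. c * \<eta> x \<partial>lborel)"
  proof (rule integral_cball_tendsto[where z=z and s=R and C=c])
    show "f n \<in> borel_measurable borel" for n unfolding f_def[abs_def] by measurable
    show "norm (f n x) \<le> c" for n x
    proof -
      have "c * \<eta> x \<le> c * 1" using c \<eta>b(2) by (intro mult_left_mono) auto
      then show ?thesis using fb[of n x] by simp
    qed
    show "AE x in lborel. x \<in> cball z R \<longrightarrow> (\<lambda>n. f n x) \<longlonglongrightarrow> c * \<eta> x"
      using pos
    proof eventually_elim
      case (elim x)
      have "(\<lambda>n. f n x) \<longlonglongrightarrow> c * \<eta> x"
      proof (cases "x \<in> ball z R")
        case True
        then have u: "U x > 0" using elim by simp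
        have "(\<lambda>n. 1 / real (Suc n)) \<longlonglongrightarrow> 0" by (rule LIMSEQ_Suc[OF lim_const_over_n])
        then have "(\<lambda>n. f n x) \<longlonglongrightarrow> c * (\<eta> x * (U x / (U x + 0)) powr (p - 1))"
          unfolding f_def using u by (intro tendsto_intros) auto
        then show ?thesis using u by simp
      qed (simp add: f_def \<eta>0)
      then show ?case ..
    qed
  qed (auto simp: f_def \<eta>0)
  then have "(\<integral>x. c * \<eta> x \<partial>lborel) \<le> ?V" by (rule LIMSEQ_le_const2) (use le in blast)
  moreover have "flat 0 (3/4) ^ k * measure lborel (cball z (R/2)) \<le> integral\<^sup>L lborel \<eta>"
  proof -
    have "(\<integral>x. flat 0 (3/4) ^ k * indicator (cball z (R/2)) x \<partial>lborel) \<le> integral\<^sup>L lborel \<eta>"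
    proof (rule integral_mono')
      show "integrable lborel \<eta>"
        by (rule integrable_cball_support[where z=z and s=R and C=1]) (use \<eta>b \<eta>0 in auto)
      show "flat 0 (3/4) ^ k * indicator (cball z (R/2)) x \<le> \<eta> x" for x
      proof (cases "x \<in> cball z (R/2)")
        case True
        \<comment> \<open>On the ball of half the radius the profile is evaluated at 1 - (1/2)^2 =
          3/4 or more.\<close>
        have "flat 0 (1 - (R/2)\<^sup>2 / R\<^sup>2) \<le> bump z R x" using True R by (intro bump_ge) auto
        then have "flat 0 (3/4) \<le> bump z R x" using R by (simp add: power_divide)
        then show ?thesis using True by (auto simp: \<eta>_def flat_bounds intro!: power_mono)
      qed (use \<eta>b in auto)
    qed (use \<eta>b in auto)
    then show ?thesis by simp
  qed
  then have "c * (flat 0 (3/4) ^ k * measure lborel (cball z (R/2))) \<le> c * integral\<^sup>L lborel \<eta>"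
    using c by (intro mult_left_mono) auto
  ultimately show ?thesis by simp
qed

end

section \<open>The half-space\<close>

lemma half_space_eq_Times: "(half_space :: ('a::euclidean_space \<times> real) set) = UNIV \<times> {0<..}"
  by (auto simp: half_space_def)

lemma closure_half_space: "closure (half_space :: ('a::euclidean_space \<times> real) set) = {x. snd x \<ge> 0}"
  by (auto simp: half_space_eq_Times closure_Times)

lemma open_half_space: "open (half_space :: ('a::euclidean_space \<times> real) set)"
  by (simp add: half_space_eq_Times open_Times)

lemma cball_subset_half_space:
  fixes a :: "'a::euclidean_space"
  assumes "r < t" shows "cball (a, t) r \<subseteq> half_space"
proof
  fix y assume "y \<in> cball (a, t) r"
  then have "\<bar>t - snd y\<bar> \<le> r" using dist_snd_le[of "(a, t)" y] by (simp add: dist_real_def)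
  then show "y \<in> half_space" using assms by (simp add: half_space_def)
qed

text \<open>The squared distance of x to (0, n) is n^2 - 2 n x_n + |x|^2, and n > b says exactly
  that this is below n^2 - 4, hence below (n - 2/n)^2. The deficit 2/n leaves room for a further
  margin 1/n inside the half-space.\<close>

lemma half_space_exhaustion:
  fixes x :: "'a::euclidean_space \<times> real"
  assumes "x \<in> half_space"
  shows "\<forall>\<^sub>F n in sequentially. x \<in> ball (0, real n) (real n - 2 / real n)"
proof -
  define b where "b = ((norm (fst x))\<^sup>2 + (snd x)\<^sup>2 + 4) / (2 * snd x)"
  have s: "snd x > 0" using assms by (simp add: half_space_def)
  have "\<forall>\<^sub>F n in sequentially. real n > max b 2"
    using filterlim_at_top_dense[THEN iffD1, OF filterlim_real_sequentially] by blast
  then show ?thesis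
  proof eventually_elim
    case (elim n)
    then have n: "real n > b" "real n > 2" by auto
    have "2 * snd x * real n > 2 * snd x * b" using n s by simp
    then have "2 * snd x * real n > (norm (fst x))\<^sup>2 + (snd x)\<^sup>2 + 4"
      using s by (simp add: b_def)
    then have "(norm (fst x))\<^sup>2 + (real n - snd x)\<^sup>2 < (real n)\<^sup>2 - 4"
      by (simp add: power2_diff mult_ac)
    also have "\<dots> \<le> (real n - 2 / real n)\<^sup>2"
      using n by (simp add: power2_diff power_divide)
    finally have *: "(norm (fst x))\<^sup>2 + (real n - snd x)\<^sup>2 < (real n - 2 / real n)\<^sup>2" .
    have "2 / real n \<le> 1" using n by (simp add: divide_le_eq_1)
    then have "sqrt ((norm (fst x))\<^sup>2 + (real n - snd x)\<^sup>2) < real n - 2 / real n"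
      using * n by (intro real_less_lsqrt) linarith+
    then show ?case by (cases x) (simp add: dist_norm norm_Pair)
  qed
qed

section \<open>Borel representatives and the lower bound for f\<close>

text \<open>Each coordinate of a Lebesgue measurable function has a Borel version. Setting the
  result to 0 where it is too large changes it only on a null subset of \<Omega> and yields a bound
  valid at every point.\<close>

lemma borel_version_on_open:
  fixes G :: "'a::euclidean_space \<Rightarrow> 'b::euclidean_space"
  assumes \<Omega>: "open \<Omega>" and G: "G \<in> borel_measurable (lebesgue_on \<Omega>)"
    and M: "AE x in lebesgue_on \<Omega>. norm (G x) \<le> M"
  obtains g where "g \<in> borel_measurable borel" "\<And>x. norm (g x) \<le> max M 0" "AE x in lebesgue_on \<Omega>. g x = G x"
proof -
  have \<Omega>l: "\<Omega> \<in> sets lebesgue" using \<Omega> by auto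
  define h where "h x = (if x \<in> \<Omega> then G x else 0)" for x
  have h: "h \<in> borel_measurable lebesgue"
    unfolding h_def[abs_def] using G \<Omega>l by (simp add: borel_measurable_if)
  have "\<exists>k. k \<in> borel_measurable borel \<and> (AE x in lborel. h x \<bullet> i = k x)" for i
    using completion_ex_borel_measurable_real[of "\<lambda>x. h x \<bullet> i" lborel] h by auto
  then obtain k where k: "\<And>i. k i \<in> borel_measurable borel" "\<And>i. AE x in lborel. h x \<bullet> i = k i x"
    by metis
  define g where "g x = (let s = (\<Sum>i\<in>Basis. k i x *\<^sub>R i) in if norm s \<le> max M 0 then s else 0)" for x
  have m: "(\<lambda>x. \<Sum>i\<in>Basis. k i x *\<^sub>R i) \<in> borel_measurable borel"
    by (intro borel_measurable_sum borel_measurable_scaleR k(1)) auto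
  have "AE x in lborel. \<forall>i\<in>Basis. h x \<bullet> i = k i x" by (intro AE_finite_allI k(2)) auto
  then have "AE x in lebesgue. \<forall>i\<in>Basis. h x \<bullet> i = k i x" by (simp add: AE_completion)
  then have a: "AE x in lebesgue. (\<Sum>i\<in>Basis. k i x *\<^sub>R i) = h x"
  proof eventually_elim
    case (elim x)
    then have "(\<Sum>i\<in>Basis. k i x *\<^sub>R i) = (\<Sum>i\<in>Basis. (h x \<bullet> i) *\<^sub>R i)" by (intro sum.cong) auto
    then show ?case by (simp add: euclidean_representation)
  qed
  show ?thesis
  proof (rule that[of g])
    show "g \<in> borel_measurable borel" unfolding g_def[abs_def] Let_def using m by measurable
    show "norm (g x) \<le> max M 0" for x by (simp add: g_def Let_def)
    have M': "AE x in lebesgue. x \<in> \<Omega> \<longrightarrow> norm (G x) \<le> M"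
      using M \<Omega>l by (simp add: AE_restrict_space_iff)
    have "AE x in lebesgue. x \<in> \<Omega> \<longrightarrow> g x = G x"
      using a M'
    proof eventually_elim
      case (elim x)
      then show ?case by (auto simp: g_def Let_def h_def)
    qed
    then show "AE x in lebesgue_on \<Omega>. g x = G x" using \<Omega>l by (simp add: AE_restrict_space_iff)
  qed
qed

text \<open>Removes the restricted and completed measure of the definitions: a Borel function
  vanishing off \<Omega> has the same integral over \<Omega> and over the whole space, with or
  without completion.\<close>

lemma integral_lebesgue_on_eq_lborel:
  fixes f1 f2 :: "'a::euclidean_space \<Rightarrow> 'b::euclidean_space"
  assumes \<Omega>: "open \<Omega>" and "f1 \<in> borel_measurable (lebesgue_on \<Omega>)" and f2: "f2 \<in> borel_measurable borel"
    and "AE x in lebesgue_on \<Omega>. f1 x = f2 x" and "\<And>x. x \<notin> \<Omega> \<Longrightarrow> f2 x = 0"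
  shows "integral\<^sup>L (lebesgue_on \<Omega>) f1 = integral\<^sup>L lborel f2"
proof -
  have f2l: "f2 \<in> borel_measurable lebesgue" using f2 by (simp add: measurable_completion)
  have "integral\<^sup>L (lebesgue_on \<Omega>) f1 = integral\<^sup>L (lebesgue_on \<Omega>) f2"
    using assms f2l by (intro integral_cong_AE) (auto intro: measurable_restrict_space1)
  also have "\<dots> = (\<integral>x. indicator \<Omega> x *\<^sub>R f2 x \<partial>lebesgue)"
    using \<Omega> by (subst integral_restrict_space) auto
  also have "(\<lambda>x. indicator \<Omega> x *\<^sub>R f2 x) = f2" using assms(5) by (auto simp: indicator_def)
  also have "integral\<^sup>L lebesgue f2 = integral\<^sup>L lborel f2" using f2 by (intro integral_completion) simp
  finally show ?thesis .
qed

text \<open>Near 0 the limit gives the factor l/2. Beyond the threshold d, the larger exponent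
  helps: t^q = t^(q-s) t^s is at least d^(q-s) t^s. At t = 0 the convention
  \<open>0 powr s = 0\<close> leaves only f 0 \<ge> 0.\<close>

lemma powr_lower_bound_of_limit:
  fixes f :: "real \<Rightarrow> real"
  assumes "q > s" "s > 0" "((\<lambda>t. f t / t powr s) \<longlongrightarrow> l) (at_right 0)" "l > 0" "c > 0"
    and "\<And>t. t > 0 \<Longrightarrow> f t \<ge> c * t powr q" and "f 0 \<ge> 0"
  obtains c' where "c' > 0" "\<And>t. t \<ge> 0 \<Longrightarrow> f t \<ge> c' * t powr s"
proof -
  have "\<forall>\<^sub>F t in at_right 0. f t / t powr s > l/2" using assms(3,4) by (intro order_tendstoD) auto
  then obtain d where d: "d > 0" "\<And>t. 0 < t \<Longrightarrow> t < d \<Longrightarrow> f t / t powr s > l/2"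
    unfolding eventually_at_right_field by auto
  show ?thesis
  proof (rule that[of "min (l/2) (c * d powr (q - s))"])
    show "min (l/2) (c * d powr (q - s)) > 0" using assms d by auto
    fix t :: real assume "t \<ge> 0"
    consider "t = 0" | "0 < t" "t < d" | "t \<ge> d" "t > 0" using \<open>t \<ge> 0\<close> by linarith
    then show "f t \<ge> min (l/2) (c * d powr (q - s)) * t powr s"
    proof cases
      case 1
      then show ?thesis using assms(7) by simp
    next
      case 2
      then have "l/2 * t powr s \<le> f t" using d(2)[of t] by (simp add: pos_less_divide_eq)
      moreover have "min (l/2) (c * d powr (q - s)) * t powr s \<le> l/2 * t powr s" by (intro mult_right_mono) auto
      ultimately show ?thesis by linarith
    next
      case 3
      have "min (l/2) (c * d powr (q - s)) * t powr s \<le> (c * d powr (q - s)) * t powr s" by (intro mult_right_mono) auto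
      also have "\<dots> \<le> (c * t powr (q - s)) * t powr s"
        using assms d 3 by (intro mult_right_mono mult_left_mono powr_mono2) auto
      also have "\<dots> = c * t powr q" using 3 by (simp flip: powr_add)
      also have "\<dots> \<le> f t" using assms(6) 3 by simp
      finally show ?thesis .
    qed
  qed
qed

text \<open>The exhausting balls eventually all contain \<open>x1\<close>, so positivity at this one
  point spreads to almost all of the half-space. It then holds on balls of any size, and a large one
  violates the bound for positive solutions.\<close>

lemma p_laplace_core_half_space_eq_0:
  fixes U F :: "'b::euclidean_space \<times> real \<Rightarrow> real"
  assumes "p_laplace_core half_space p M c U F g" and "x1 \<in> half_space"
  shows "U x1 = 0"
proof (rule ccontr)
  interpret p_laplace_core half_space p M c U F g by fact
  assume "U x1 \<noteq> 0"
  then have x1: "U x1 > 0" using U(2)[of x1] by simp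
  have "AE x in lborel. x \<in> half_space \<longrightarrow> U x > 0"
  proof -
    obtain N where N: "\<And>n. n \<ge> N \<Longrightarrow> x1 \<in> ball (0, real n) (real n - 2 / real n)"
      using half_space_exhaustion[OF assms(2)] by (auto simp: eventually_sequentially)
    \<comment> \<open>One null set has to serve all balls, which the countability of n provides. The
      restriction on n puts \<open>x1\<close> into the ball and makes the margin 1/n
      positive.\<close>
    have "AE x in lborel. \<forall>n. n \<ge> max N 1 \<longrightarrow> x \<in> ball (0, real n) (real n - 2 / real n) \<longrightarrow> U x > 0"
    proof (subst AE_all_countable, intro allI)
      fix n :: nat
      show "AE x in lborel. n \<ge> max N 1 \<longrightarrow> x \<in> ball (0, real n) (real n - 2 / real n) \<longrightarrow> U x > 0"
      proof (cases "n \<ge> max N 1")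
        case True
        then have "AE x in lborel. x \<in> ball (0, real n) (real n - 2 / real n) \<longrightarrow> U x > 0"
        proof (intro strong_maximum_principle[where e="1 / real n"])
          show "cball (0::'b, real n) (real n - 2 / real n + 1 / real n) \<subseteq> half_space"
            using True by (intro cball_subset_half_space) (simp add: field_simps)
          show x1n: "x1 \<in> ball (0, real n) (real n - 2 / real n)" using N True by simp
          then show "real n - 2 / real n > 0" by (metis ball_empty empty_iff not_le)
        qed (use x1 True in auto)
        then show ?thesis by simp
      next
        case False
        then show ?thesis by (intro AE_I2) blast
      qed
    qed
    then show ?thesis
    proof eventually_elim
      case (elim x)
      show ?case
      proof
        assume "x \<in> half_space"
        then obtain N' where "\<And>n. n \<ge> N' \<Longrightarrow> x \<in> ball (0, real n) (real n - 2 / real n)"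
          using half_space_exhaustion[OF \<open>x \<in> half_space\<close>] unfolding eventually_sequentially by blast
        then show "U x > 0" using elim[rule_format, of "max N' (max N 1)"] by simp
      qed
    qed
  qed
  then have pos: "AE x in lborel. x \<in> ball z R \<longrightarrow> U x > 0" if "cball z R \<subseteq> half_space" for z R
    by (rule eventually_mono) (use that ball_subset_cball in blast)
  obtain k :: nat where k: "real k \<ge> p" using real_arch_simple by blast
  have k0: "k > 0" using k p by linarith
  let ?d = "DIM('b \<times> real)"
  \<comment> \<open>Halving the radius divides the volume by 2^d, so dividing the bound by the
    volume of the full ball leaves a \<le> (8k/R)^p.\<close>
  define a where "a = c * flat 0 (3/4) ^ k / 2 ^ ?d"
  have a: "a > 0" using c by (simp add: a_def flat_0)
  \<comment> \<open>Solves (8k/R)^p = a/2, which is less than a.\<close>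
  define R where "R = 8 * real k / (a/2) powr (1/p)"
  have R: "R > 0" using a k0 by (simp add: R_def)
  have sub: "cball (0::'b, R + 1) (R + 1/2) \<subseteq> half_space" by (intro cball_subset_half_space) simp
  have "c * (flat 0 (3/4) ^ k * measure lborel (cball (0::'b, R + 1) (R/2)))
      \<le> (8 * real k / R) powr p * measure lborel (cball (0::'b, R + 1) R)"
    using sub by (intro positive_solution_bound[OF _ _ R k, of "1/2"] pos cball_subset_half_space) auto
  then have "a * (unit_ball_vol (real ?d) * R ^ ?d) \<le> (8 * real k / R) powr p * (unit_ball_vol (real ?d) * R ^ ?d)"
    using R by (simp add: content_cball a_def power_divide mult_ac)
  moreover have "unit_ball_vol (real ?d) * R ^ ?d > 0"
    using R by (intro mult_pos_pos unit_ball_vol_pos) auto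
  ultimately have "a \<le> (8 * real k / R) powr p" by (simp add: mult_le_cancel_right)
  also have "8 * real k / R = (a/2) powr (1/p)" using k0 a by (simp add: R_def)
  also have "((a/2) powr (1/p)) powr p = a/2" using a p by (simp add: powr_powr)
  finally show False using a by simp
qed

theorem corollary2:
  fixes p q l c :: real and f :: "real \<Rightarrow> real"
  assumes "p \<ge> 2" and "q > p - 1"
    and "\<And>t. t \<ge> 0 \<Longrightarrow> f t \<ge> 0"
    and "\<And>t. t > 0 \<Longrightarrow> f t > 0"
    and "local_lipschitz (UNIV :: real set) {0<..} (\<lambda>_. f)"
    and "continuous (at 0 within {0..}) f"
    and "((\<lambda>t. f t / t powr (p - 1)) \<longlongrightarrow> l) (at_right 0)" and "l > 0"
    and "c > 0" and "\<And>t. t > 0 \<Longrightarrow> f t \<ge> c * t powr q"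
  shows "\<not> (\<exists>u :: (real ^ 'm) \<times> real \<Rightarrow> real.
      u \<in> W1p_loc p half_space \<inter> Lp_loc q half_space \<and>
      weak_gradient half_space u \<in> Linfty half_space \<and>
      (AE x in lebesgue_on half_space. u x \<ge> 0) \<and>
      \<not> (AE x in lebesgue_on half_space. u x = 0) \<and>
      p_laplace_solution p f half_space u \<and>
      zero_on_boundary half_space u)"
proof
  let ?\<Omega> = "half_space :: ((real ^ 'm) \<times> real) set"
  assume "\<exists>u :: (real ^ 'm) \<times> real \<Rightarrow> real.
      u \<in> W1p_loc p half_space \<inter> Lp_loc q half_space \<and>
      weak_gradient half_space u \<in> Linfty half_space \<and>
      (AE x in lebesgue_on half_space. u x \<ge> 0) \<and>
      \<not> (AE x in lebesgue_on half_space. u x = 0) \<and>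
      p_laplace_solution p f half_space u \<and>
      zero_on_boundary half_space u"
  then obtain u where u: "u \<in> W1p_loc p ?\<Omega>" "weak_gradient ?\<Omega> u \<in> Linfty ?\<Omega>"
      "AE x in lebesgue_on ?\<Omega>. u x \<ge> 0" "\<not> (AE x in lebesgue_on ?\<Omega>. u x = 0)"
      "p_laplace_solution p f ?\<Omega> u" "zero_on_boundary ?\<Omega> u" by blast
  define G where "G = weak_gradient ?\<Omega> u"
  \<comment> \<open>The chosen \<open>weak_gradient\<close> really is one, because membership in
    \<open>W1p_loc\<close> provides a witness for the choice.\<close>
  have wg: "has_weak_gradient ?\<Omega> u G"
    using u(1) someI_ex[of "has_weak_gradient ?\<Omega> u"] unfolding G_def weak_gradient_def W1p_loc_def by blast
  obtain M where M: "G \<in> borel_measurable (lebesgue_on ?\<Omega>)" "AE x in lebesgue_on ?\<Omega>. norm (G x) \<le> M"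
    using u(2) unfolding Linfty_def G_def by blast
  obtain g where g: "g \<in> borel_measurable borel" "\<And>x. norm (g x) \<le> max M 0" "AE x in lebesgue_on ?\<Omega>. g x = G x"
    using borel_version_on_open[OF open_half_space M] by blast
  obtain v where v: "AE x in lebesgue_on ?\<Omega>. v x = u x" "continuous_on (closure ?\<Omega>) v"
    using u(6) unfolding zero_on_boundary_def by blast
  \<comment> \<open>Even reflection in the last variable extends the representative continuously to
    the whole space, and the absolute value makes it nonnegative everywhere; in the half-space both
    change it on a null set at most.\<close>
  define U where "U x = \<bar>v (fst x, \<bar>snd x\<bar>)\<bar>" for x
  have Uc: "continuous_on UNIV U" unfolding U_def[abs_def]
    by (intro continuous_intros continuous_on_compose2[OF v(2)]) (auto simp: closure_half_space)
  have Uu: "AE x in lebesgue_on ?\<Omega>. U x = u x"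
    using v(1) u(3) AE_space[of "lebesgue_on ?\<Omega>"]
  proof eventually_elim
    case (elim x)
    then have "snd x > 0" by (simp add: half_space_def)
    then show ?case using elim by (simp add: U_def)
  qed
  \<comment> \<open>\<open>U\<close> may take the value 0, so continuity on the open half-line is
    joined with continuity at 0 to make \<open>F\<close> continuous everywhere.\<close>
  have fc: "continuous_on {0..} f"
  proof -
    have "continuous_on {0<..} f"
      using local_lipschitz_continuous_on[OF assms(5)] by blast
    then have "continuous (at x within {0..}) f" if "x > 0" for x
      using that by (simp add: continuous_on_eq_continuous_at continuous_at_imp_continuous_at_within)
    then show ?thesis using assms(6) by (auto simp: continuous_on_eq_continuous_within order_le_less)
  qed
  define F where "F x = f (U x)" for x
  have Fc: "continuous_on UNIV F"
    unfolding F_def by (intro continuous_on_compose2[OF fc Uc]) (auto simp: U_def)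
  obtain c' where c': "c' > 0" "\<And>t. t \<ge> 0 \<Longrightarrow> f t \<ge> c' * t powr (p - 1)"
    using powr_lower_bound_of_limit[OF assms(2) _ assms(7-10), of thesis] assms(1,3) by simp
  have bU: "U \<in> borel_measurable borel" "F \<in> borel_measurable borel"
    using Uc Fc by (auto intro: borel_measurable_continuous_onI)
  have lm: "h \<in> borel_measurable (lebesgue_on ?\<Omega>)" if "h \<in> borel_measurable borel" for h :: "_ \<Rightarrow> 'z::euclidean_space"
    using that by (simp add: measurable_completion measurable_restrict_space1)
  have test: "\<psi> \<in> borel_measurable borel" "gradient \<psi> \<in> borel_measurable borel"
      "x \<notin> ?\<Omega> \<Longrightarrow> \<psi> x = 0" "x \<notin> ?\<Omega> \<Longrightarrow> gradient \<psi> x = 0"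
    if "\<psi> \<in> test_functions ?\<Omega>" for \<psi> x
  proof -
    have s: "smooth_on UNIV \<psi>" and K: "closure {x. \<psi> x \<noteq> 0} \<subseteq> ?\<Omega>"
      using that by (auto simp: test_functions_def)
    show "\<psi> \<in> borel_measurable borel" "gradient \<psi> \<in> borel_measurable borel"
      by (auto intro!: borel_measurable_continuous_onI smooth_on_continuous continuous_on_gradient s)
    have out: "y \<notin> closure {x. \<psi> x \<noteq> 0} \<Longrightarrow> \<psi> y = 0" for y
      using closure_subset[of "{x. \<psi> x \<noteq> 0}"] by blast
    show "\<psi> x = 0" "gradient \<psi> x = 0" if "x \<notin> ?\<Omega>"
      using that K out gradient_eq_0_outside[OF s closed_closure out] by blast+
  qed
  have "p_laplace_core ?\<Omega> p (max M 0) c' U F g"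
  proof
    fix \<psi> assume \<psi>: "\<psi> \<in> test_functions ?\<Omega>"
    note [measurable] = test(1,2)[OF \<psi>] g(1) bU
    have u_m: "u \<in> borel_measurable (lebesgue_on ?\<Omega>)" using u(1) by (auto simp: W1p_loc_def Lp_loc_def)
    have "(\<integral>x. u x *\<^sub>R gradient \<psi> x \<partial>lebesgue_on ?\<Omega>) = (\<integral>x. U x *\<^sub>R gradient \<psi> x \<partial>lborel)"
      using Uu test(4)[OF \<psi>] u_m lm[OF test(2)[OF \<psi>]]
      by (intro integral_lebesgue_on_eq_lborel open_half_space borel_measurable_scaleR) auto
    moreover have "(\<integral>x. \<psi> x *\<^sub>R G x \<partial>lebesgue_on ?\<Omega>) = (\<integral>x. \<psi> x *\<^sub>R g x \<partial>lborel)"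
      using g(3) test(3)[OF \<psi>] M(1) lm[OF test(1)[OF \<psi>]]
      by (intro integral_lebesgue_on_eq_lborel open_half_space borel_measurable_scaleR) auto
    ultimately show "(\<integral>x. U x *\<^sub>R gradient \<psi> x \<partial>lborel) = - (\<integral>x. \<psi> x *\<^sub>R g x \<partial>lborel)"
      using wg \<psi> unfolding has_weak_gradient_def by simp
    let ?A = "\<lambda>x. (norm (G x) powr (p - 2) *\<^sub>R G x) \<bullet> gradient \<psi> x"
    \<comment> \<open>The integrability conjuncts also supply the measurability of both integrands,
      which the passage to Borel representatives requires.\<close>
    have sol: "integrable (lebesgue_on ?\<Omega>) ?A" "integrable (lebesgue_on ?\<Omega>) (\<lambda>x. f (u x) * \<psi> x)"
        "integral\<^sup>L (lebesgue_on ?\<Omega>) ?A = (\<integral>x. f (u x) * \<psi> x \<partial>lebesgue_on ?\<Omega>)"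
      using u(5) \<psi> unfolding p_laplace_solution_def G_def by blast+
    have "integral\<^sup>L (lebesgue_on ?\<Omega>) ?A = (\<integral>x. (norm (g x) powr (p - 2) *\<^sub>R g x) \<bullet> gradient \<psi> x \<partial>lborel)"
      using g(3) test(4)[OF \<psi>] borel_measurable_integrable[OF sol(1)]
      by (intro integral_lebesgue_on_eq_lborel open_half_space) auto
    moreover have "AE x in lebesgue_on ?\<Omega>. f (u x) * \<psi> x = F x * \<psi> x"
      using Uu by eventually_elim (simp add: F_def)
    then have "(\<integral>x. f (u x) * \<psi> x \<partial>lebesgue_on ?\<Omega>) = (\<integral>x. F x * \<psi> x \<partial>lborel)"
      using test(3)[OF \<psi>] borel_measurable_integrable[OF sol(2)]
      by (intro integral_lebesgue_on_eq_lborel open_half_space) auto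
    ultimately show "(\<integral>x. (norm (g x) powr (p - 2) *\<^sub>R g x) \<bullet> gradient \<psi> x \<partial>lborel) = (\<integral>x. F x * \<psi> x \<partial>lborel)"
      using sol(3) by simp
  qed (use assms(1) Uc g Fc c' in \<open>auto simp: U_def F_def\<close>)
  then have "U x = 0" if "x \<in> ?\<Omega>" for x by (rule p_laplace_core_half_space_eq_0[OF _ that])
  then have "AE x in lebesgue_on ?\<Omega>. u x = 0"
    using Uu AE_space[of "lebesgue_on ?\<Omega>"] by (auto elim: eventually_elim2)
  then show False using u(4) by blast
qed

end
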